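(* Let $\mathcal{P} \subset \mathbb{R}^N$ be an integral convex polytope of dimension $d$. Then \[ 1 \leq \mu_{\mathrm{va}}(\mathcal{P}) \leq \mu_{\mathrm{midp}}(\mathcal{P}) \leq \mu_{\mathrm{idp}}(\mathcal{P}) \leq \mu_{\mathrm{hole}}(\mathcal{P}) \leq \mu_{\mathrm{Ehr}}(\mathcal{P}) \leq d \] and \[ 1 \leq \mu_{\mathrm{va}}(\mathcal{P}) \leq \mu_{\mathrm{Hilb}}(\mathcal{P}) \leq \mu_{\mathrm{hole}}(\mathcal{P}) \leq d-1. \]
   Context: An integral convex polytope is a convex polytope whose vertices lie in $\mathbb{Z}^N$; $k\mathcal{P}=\{k\alpha:\alpha\in\mathcal{P}\}$. A polytope $\mathcal{Q}$ has the integer decomposition property (IDP) if for every integer $k\ge 1$ and every $\alpha\in k\mathcal{Q}\cap\mathbb{Z}^N$ there are $\alpha_1,\dots,\alpha_k\in\mathcal{Q}\cap\mathbb{Z}^N$ with $\alpha=\alpha_1+\cdots+\alpha_k$; $\mathcal{Q}$ is very ample if this holds for all sufficiently large $k$. Let $\widetilde{\mathcal{P}}=\{(\alpha,1):\alpha\in\mathcal{P}\}\subset\mathbb{R}^{N+1}$ and $\mathcal{C}(\mathcal{P})$ the cone generated by the vertices of $\widetilde{\mathcal{P}}$; the degree of $(\alpha,n)\in\mathcal{C}(\mathcal{P})\cap\mathbb{Z}^{N+1}$ is $n$. $\mathcal{H}(\mathcal{C}(\mathcal{P}))$ denotes the unique minimal Hilbert basis of $\mathcal{C}(\mathcal{P})$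 (minimal finite set of integer vectors whose nonnegative integer combinations give $\mathcal{C}(\mathcal{P})\cap\mathbb{Z}^{N+1}$). A simplex $\mathcal{S}$ is empty if $\mathcal{S}\cap\mathbb{Z}^N$ is its vertex set; for an empty simplex with vertices $v_i$, $\mathrm{Box}(\mathcal{S})=\{\sum_i r_i(v_i,1)\in\mathbb{Z}^{N+1}: 0\le r_i<1\}$. Define $\mathrm{Box}(\mathcal{P})=\bigcup_{\mathcal{S}}\mathrm{Box}(\mathcal{S})\setminus \mathbb{Z}_{\ge0}(\widetilde{\mathcal{P}}\cap\mathbb{Z}^{N+1})$, the union over all empty $d$-dimensional simplices $\mathcal{S}\subset\mathcal{P}$ (here $\mathbb{Z}_{\ge 0}(X)$ denotes nonnegative integer combinations of elements of $X$). The $\delta$-vector $(\delta_0,\dots,\delta_d)$ of $\mathcal{P}$ is defined by $\sum_{n\ge0}|n\mathcal{P}\cap\mathbb{Z}^N|t^n=(\sum_{i=0}^d\delta_it^i)/(1-t)^{d+1}$. Invariants: $\mu_{\mathrm{va}}(\mathcal{P})$ = smallest $k>0$ with $k\mathcal{P}$ very ample; $\mu_{\mathrm{midp}}(\mathcal{P})$ = smallest $k>0$ with $k\mathcal{P}$ having IDP; $\mu_{\mathrm{idp}}(\mathcal{P})$ = smallest $k>0$ such that $n\mathcal{P}$ has IDP for all $n\ge k$; $\mu_{\mathrm{Hilb}}(\mathcal{P})$ = maximal degree of elements of $\mathcal{H}(\mathcal{C}(\mathcal{P}))$; $\mu_{\mathrm{hole}}(\mathcal{P})$ = maximal degree of elements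 of $\mathrm{Box}(\mathcal{P})$, with $\mu_{\mathrm{hole}}(\mathcal{P})=1$ if $\mathrm{Box}(\mathcal{P})=\emptyset$; $\mu_{\mathrm{Ehr}}(\mathcal{P})$ = largest integer $i>0$ with $\delta_i\ne0$.
   Formalization: The dimension is assumed to be d ≥ 1 (the claim fails for d = 0); the bound μ_hole ≤ d−1 is asserted only for d ≥ 2 (it fails for a segment, d = 1); and μ_Ehr is set to 1 when no δ_i with i > 0 is nonzero (e.g. a unimodular simplex), where it is otherwise undefined. *)

theory Defs
  imports "HOL-Analysis.Analysis" "HOL-Computational_Algebra.Formal_Power_Series"
begin

text \<open>Ambient space R^N is real^'n (N = CARD('n)); R^(N+1) is (real^'n) \<times> real,
  the last coordinate being the degree.\<close>

definition lattice :: "(real^'n) set" where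
  "lattice = {x. \<forall>i. x $ i \<in> \<int>}"

definition lattice1 :: "((real^'n) \<times> real) set" where
  "lattice1 = {(x, t). x \<in> lattice \<and> t \<in> \<int>}"

definition integral_polytope :: "(real^'n) set \<Rightarrow> bool" where
  "integral_polytope P \<longleftrightarrow> polytope P \<and> {v. v extreme_point_of P} \<subseteq> lattice"

definition dilate :: "real \<Rightarrow> (real^'n) set \<Rightarrow> (real^'n) set" where
  "dilate k P = (\<lambda>x. k *\<^sub>R x) ` P"

definition decomp_at :: "(real^'n) set \<Rightarrow> nat \<Rightarrow> bool" where
  "decomp_at Q k \<longleftrightarrow> (\<forall>\<alpha> \<in> dilate (real k) Q \<inter> lattice.
      \<exists>f. (\<forall>i<k. f i \<in> Q \<inter> lattice) \<and> \<alpha> = (\<Sum>i<k. f i))"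

definition IDP :: "(real^'n) set \<Rightarrow> bool" where
  "IDP Q \<longleftrightarrow> (\<forall>k\<ge>1. decomp_at Q k)"

definition very_ample :: "(real^'n) set \<Rightarrow> bool" where
  "very_ample Q \<longleftrightarrow> (\<exists>k0. \<forall>k\<ge>k0. decomp_at Q k)"

definition mu_va :: "(real^'n) set \<Rightarrow> nat" where
  "mu_va P = (LEAST k. 0 < k \<and> very_ample (dilate (real k) P))"

definition mu_midp :: "(real^'n) set \<Rightarrow> nat" where
  "mu_midp P = (LEAST k. 0 < k \<and> IDP (dilate (real k) P))"

definition mu_idp :: "(real^'n) set \<Rightarrow> nat" where
  "mu_idp P = (LEAST k. 0 < k \<and> (\<forall>n\<ge>k. IDP (dilate (real n) P)))"

definition lift :: "(real^'n) set \<Rightarrow> ((real^'n) \<times> real) set" where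
  "lift P = (\<lambda>x. (x, 1)) ` P"

definition nonneg_int_comb :: "((real^'n) \<times> real) set \<Rightarrow> ((real^'n) \<times> real) set" where
  "nonneg_int_comb X = {y. \<exists>U (c :: (real^'n) \<times> real \<Rightarrow> nat). finite U \<and> U \<subseteq> X \<and>
      y = (\<Sum>u\<in>U. real (c u) *\<^sub>R u)}"

definition cone_of :: "(real^'n) set \<Rightarrow> ((real^'n) \<times> real) set" where
  "cone_of P = {y. \<exists>U c. finite U \<and> U \<subseteq> lift {v. v extreme_point_of P} \<and>
      (\<forall>u\<in>U. 0 \<le> c u) \<and> y = (\<Sum>u\<in>U. c u *\<^sub>R u)}"

definition deg :: "(real^'n) \<times> real \<Rightarrow> nat" where
  "deg y = nat \<lfloor>snd y\<rfloor>"

definition hilbert_basis :: "(real^'n) set \<Rightarrow> ((real^'n) \<times> real) set" where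
  "hilbert_basis P = (THE H. finite H \<and> H \<subseteq> cone_of P \<inter> lattice1 \<and>
      nonneg_int_comb H = cone_of P \<inter> lattice1 \<and>
      (\<forall>H'. H' \<subset> H \<longrightarrow> nonneg_int_comb H' \<noteq> cone_of P \<inter> lattice1))"

definition mu_Hilb :: "(real^'n) set \<Rightarrow> nat" where
  "mu_Hilb P = Max (deg ` hilbert_basis P)"

definition empty_simplex :: "(real^'n) set \<Rightarrow> nat \<Rightarrow> (real^'n) set \<Rightarrow> bool" where
  "empty_simplex P e W \<longleftrightarrow> finite W \<and> \<not> affine_dependent W \<and> card W = e + 1 \<and>
      convex hull W \<subseteq> P \<and> convex hull W \<inter> lattice = W"

definition box_simplex :: "(real^'n) set \<Rightarrow> ((real^'n) \<times> real) set" where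
  "box_simplex W = {y \<in> lattice1. \<exists>r. (\<forall>w\<in>W. 0 \<le> r w \<and> r w < 1) \<and>
      y = (\<Sum>w\<in>W. r w *\<^sub>R (w, 1))}"

definition box_poly :: "(real^'n) set \<Rightarrow> ((real^'n) \<times> real) set" where
  "box_poly P = (\<Union>W \<in> {W. empty_simplex P (nat (aff_dim P)) W}. box_simplex W)
      - nonneg_int_comb (lift P \<inter> lattice1)"

definition mu_hole :: "(real^'n) set \<Rightarrow> nat" where
  "mu_hole P = (if box_poly P = {} then 1 else Max (deg ` box_poly P))"

definition lattice_count :: "(real^'n) set \<Rightarrow> nat \<Rightarrow> nat" where
  "lattice_count P n = card (dilate (real n) P \<inter> lattice)"

definition delta :: "(real^'n) set \<Rightarrow> nat \<Rightarrow> int" where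
  "delta P = fps_nth ((1 - fps_X) ^ (nat (aff_dim P) + 1) *
      Abs_fps (\<lambda>n. int (lattice_count P n)))"

definition mu_Ehr :: "(real^'n) set \<Rightarrow> nat" where
  "mu_Ehr P = (if \<exists>i>0. delta P i \<noteq> 0 then (GREATEST i. 0 < i \<and> delta P i \<noteq> 0) else 1)"

end

theory Submission
  imports Defs
begin

text \<open>
  Let \<open>A\<close> be the set of lattice points of \<open>P\<close> at height 1. Every lattice point of the cone lies in
  the cone over an empty simplex (exchange vertices until no further point is left), hence is a sum
  of points of \<open>A\<close> and one box element. Grouping the summands by degree gives the bounds of
  \<open>mu_idp\<close> and \<open>mu_Hilb\<close> by \<open>mu_hole\<close> and of \<open>mu_va\<close> by \<open>mu_Hilb\<close>.

  For \<open>mu_hole \<le> mu_Ehr \<le> d\<close>, fix a simplex \<open>S\<close> and choose generic heights on \<open>A\<close> that vanish exactly on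
  \<open>S\<close>; they induce a regular triangulation containing \<open>S\<close>. A generic point in the interior of \<open>S\<close>
  turns it into a partition of the cone into half-open simplicial cones, so the \<open>\<delta>\<close>-vector counts the
  elements of the half-open boxes by degree. These degrees are at most \<open>d\<close>, and the half-open box of
  \<open>S\<close> is the usual box of \<open>S\<close>, so a box element of degree \<open>i\<close> forces \<open>\<delta>\<^sub>i > 0\<close>.
\<close>

section \<open>Conic combinations and simplicial cones\<close>

text \<open>With closed cones the count would need inclusion-exclusion over common faces, and a box
  element could be cancelled by the signs. With half-open cones each coefficient of the numerator is
  a sum of cardinalities, so one box element already makes it positive. Two choices are tied to the
  given simplex \<open>S\<close>. Heights 0 on \<open>S\<close> and positive elsewhere make
  \<open>S\<close> a facet of the lower hull, hence a cell. A point \<open>q\<close> inside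
  \<open>S\<close> removes no facet of the cone over \<open>S\<close>, so its half-open box keeps
  the bounds 0 \<le> r < 1 of the definition. The triangulation varies with \<open>S\<close>, the
  numerator does not. The bound \<open>d\<close> on the degrees, rather than \<open>d + 1\<close>,
  comes from \<open>q\<close> lying at positive height: over every cell some coordinate of
  \<open>q\<close> is positive, and there the upper bound of the box is strict.\<close>

definition pos_span :: "'e::real_vector set \<Rightarrow> 'e set" where
  "pos_span A = {y. \<exists>c. (\<forall>a\<in>A. 0 \<le> c a) \<and> y = (\<Sum>a\<in>A. c a *\<^sub>R a)}"

abbreviation coord :: "'e::real_vector set \<Rightarrow> 'e \<Rightarrow> 'e \<Rightarrow> real" where
  "coord \<equiv> real_vector.representation"

lemma pos_spanI: "(\<And>a. a \<in> A \<Longrightarrow> 0 \<le> c a) \<Longrightarrow> y = (\<Sum>a\<in>A. c a *\<^sub>R a) \<Longrightarrow> y \<in> pos_span A"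
  unfolding pos_span_def by blast

lemma pos_span_subset_span: "pos_span A \<subseteq> span A"
  unfolding pos_span_def by (auto intro!: span_sum intro: span_scale span_base)

lemma pos_span_add:
  assumes "x \<in> pos_span A" "y \<in> pos_span A" shows "x + y \<in> pos_span A"
proof -
  obtain c where c: "\<forall>a\<in>A. 0 \<le> c a" "x = (\<Sum>a\<in>A. c a *\<^sub>R a)"
    using assms(1) unfolding pos_span_def by blast
  obtain e where e: "\<forall>a\<in>A. 0 \<le> e a" "y = (\<Sum>a\<in>A. e a *\<^sub>R a)"
    using assms(2) unfolding pos_span_def by blast
  show ?thesis
    by (rule pos_spanI[of _ "\<lambda>a. c a + e a"]) (use c e in \<open>auto simp: scaleR_add_left sum.distrib\<close>)
qed

lemma pos_span_scale:
  assumes "x \<in> pos_span A" "0 \<le> t" shows "t *\<^sub>R x \<in> pos_span A"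
proof -
  obtain c where c: "\<forall>a\<in>A. 0 \<le> c a" "x = (\<Sum>a\<in>A. c a *\<^sub>R a)"
    using assms(1) unfolding pos_span_def by blast
  show ?thesis
    by (rule pos_spanI[of _ "\<lambda>a. t * c a"]) (use c assms in \<open>auto simp: scaleR_sum_right\<close>)
qed

lemma pos_span_0: "0 \<in> pos_span A"
  by (rule pos_spanI[of _ "\<lambda>a. 0"]) auto

lemma pos_span_sum:
  assumes "\<And>i. i \<in> I \<Longrightarrow> f i \<in> pos_span A" shows "(\<Sum>i\<in>I. f i) \<in> pos_span A"
  using assms by (induction I rule: infinite_finite_induct) (auto intro: pos_span_add pos_span_0)

lemma pos_span_base:
  assumes "finite A" "a \<in> A" shows "a \<in> pos_span A"
proof (rule pos_spanI[of _ "\<lambda>x. if x = a then 1 else 0"])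
  show "a = (\<Sum>x\<in>A. (if x = a then 1 else 0) *\<^sub>R x)"
    using assms by (simp add: if_distrib[of "\<lambda>t. t *\<^sub>R _"] cong: if_cong)
qed auto

lemma pos_span_mono:
  assumes "finite A" "B \<subseteq> pos_span A" shows "pos_span B \<subseteq> pos_span A"
proof
  fix y assume "y \<in> pos_span B"
  then obtain c where c: "\<forall>b\<in>B. 0 \<le> c b" "y = (\<Sum>b\<in>B. c b *\<^sub>R b)"
    unfolding pos_span_def by blast
  show "y \<in> pos_span A"
    unfolding c(2) by (rule pos_span_sum) (use c(1) assms in \<open>auto intro: pos_span_scale\<close>)
qed

text \<open>Take a generating subset of least cardinality. A linear relation in it could be
  subtracted until a coefficient reaches 0, which would give a smaller one.\<close>

lemma conic_caratheodory:
  assumes "finite A" "z \<in> pos_span A"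
  obtains U where "U \<subseteq> A" "independent U" "z \<in> pos_span U"
proof -
  let ?Q = "\<lambda>U. U \<subseteq> A \<and> z \<in> pos_span U"
  define U where "U = arg_min card ?Q"
  have U: "?Q U" "\<And>V. ?Q V \<Longrightarrow> card U \<le> card V"
    unfolding U_def using arg_min_natI[of ?Q A card] arg_min_nat_le[of ?Q _ card] assms by auto
  have fU: "finite U" using U(1) assms(1) finite_subset by blast
  obtain c where c: "\<forall>a\<in>U. 0 \<le> c a" "z = (\<Sum>a\<in>U. c a *\<^sub>R a)"
    using U(1) unfolding pos_span_def by blast
  have "independent U"
  proof
    assume "dependent U"
    then obtain u v where uv: "v \<in> U" "u v \<noteq> 0" "(\<Sum>a\<in>U. u a *\<^sub>R a) = 0"
      using fU by (auto simp: dependent_finite)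
    \<comment> \<open>The relation may be negated, so some coefficient is positive and the ratio
      test below has a candidate.\<close>
    obtain w where w: "w v > 0" "(\<Sum>a\<in>U. w a *\<^sub>R a) = 0"
    proof (cases "u v > 0")
      case False
      then show ?thesis using uv that[of "\<lambda>a. - u a"] by (simp add: sum_negf)
    qed (use uv that in blast)
    define W where "W = {a \<in> U. w a > 0}"
    have W: "finite W" "W \<noteq> {}" using fU uv w unfolding W_def by auto
    \<comment> \<open>Ratio test: when \<open>c\<close> moves along \<open>- w\<close>, the
      coefficient at \<open>m\<close> is the first to reach 0, at time \<open>t\<close>.\<close>
    define m where "m = arg_min_on (\<lambda>a. c a / w a) W"
    have m: "m \<in> W" "\<And>a. a \<in> W \<Longrightarrow> c m / w m \<le> c a / w a"
      unfolding m_def using arg_min_if_finite[OF W, of "\<lambda>a. c a / w a"]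
      by (auto simp: not_less)
    define t where "t = c m / w m"
    have t0: "t \<ge> 0" using m(1) c(1) unfolding t_def W_def by auto
    have nn: "c a - t * w a \<ge> 0" if "a \<in> U" for a
    proof (cases "w a > 0")
      case True
      then show ?thesis using m(2)[of a] that unfolding W_def t_def[symmetric] by (simp add: field_simps)
    next
      case False
      then show ?thesis using t0 c(1) that by (simp add: mult_nonneg_nonpos order_trans[of _ 0])
    qed
    have mU: "m \<in> U" "w m > 0" using m(1) unfolding W_def by auto
    have "z = (\<Sum>a\<in>U. (c a - t * w a) *\<^sub>R a)"
      using c(2) w(2) by (simp add: scaleR_diff_left sum_subtractf scaleR_scaleR[symmetric] scaleR_sum_right[symmetric] del: scaleR_scaleR)
    also have "\<dots> = (\<Sum>a\<in>U - {m}. (c a - t * w a) *\<^sub>R a)"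
      using mU fU by (subst sum.remove[of _ m]) (auto simp: t_def)
    finally have "z \<in> pos_span (U - {m})"
      by (rule pos_spanI[rotated]) (use nn in auto)
    then have "card U \<le> card (U - {m})" using U(1) by (intro U(2)) auto
    then show False using mU fU by (metis card_Diff1_less not_le)
  qed
  then show ?thesis using that U by blast
qed

text \<open>A homogenised point configuration. Points at height 1 of a linear functional turn affine
  statements about simplices into linear algebra of simplicial cones.\<close>

locale graded_points =
  fixes A :: "'e::real_vector set" and h :: "'e \<Rightarrow> real"
  assumes finite_A: "finite A"
    and linear_h: "linear h"
    and h_A: "\<And>a. a \<in> A \<Longrightarrow> h a = 1"
begin

text \<open>The full-dimensional simplices with vertices in \<open>A\<close>, seen through their
  homogenised vertex sets.\<close>

definition basis :: "'e set \<Rightarrow> bool" where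
  "basis B \<longleftrightarrow> B \<subseteq> A \<and> independent B \<and> A \<subseteq> span B"

lemma basis_finite: "basis B \<Longrightarrow> finite B"
  unfolding basis_def using finite_A finite_subset by blast

lemma finite_bases: "finite {B. basis B}"
  by (rule finite_subset[of _ "Pow A"]) (auto simp: basis_def finite_A)

lemma basis_span: "basis B \<Longrightarrow> span B = span A"
  unfolding basis_def by (simp add: span_eq span_superset subset_trans[OF _ span_superset])

lemma basis_card: "basis B \<Longrightarrow> card B = dim A"
  unfolding basis_def by (simp add: basis_card_eq_dim)

lemma basis_extend:
  assumes "U \<subseteq> A" "independent U"
  obtains B where "basis B" "U \<subseteq> B"
  using maximal_independent_subset_extend[OF assms] unfolding basis_def by metis

context
  fixes B assumes B: "basis B"
begin

lemma basis_simps: "B \<subseteq> A" "independent B" "finite B" "span B = span A"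
  using B basis_finite basis_span unfolding basis_def by auto

lemma coord_sum: "y \<in> span A \<Longrightarrow> (\<Sum>b\<in>B. coord B y b *\<^sub>R b) = y"
  by (rule real_vector.sum_representation_eq) (use basis_simps in auto)

lemma coord_add: "x \<in> span A \<Longrightarrow> y \<in> span A \<Longrightarrow> coord B (x + y) b = coord B x b + coord B y b"
  using real_vector.representation_add[of B y x] basis_simps by auto

lemma coord_diff: "x \<in> span A \<Longrightarrow> y \<in> span A \<Longrightarrow> coord B (x - y) b = coord B x b - coord B y b"
  using real_vector.representation_diff[of B y x] basis_simps by auto

lemma coord_scale: "x \<in> span A \<Longrightarrow> coord B (t *\<^sub>R x) b = t * coord B x b"
  using real_vector.representation_scale[of B x t] basis_simps by auto

lemma coord_base: "a \<in> B \<Longrightarrow> coord B a b = (if b = a then 1 else 0)"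
  using real_vector.representation_basis[of B a] basis_simps by auto

lemma coord_of_sum: "(\<And>i. i \<in> I \<Longrightarrow> f i \<in> span A) \<Longrightarrow> coord B (\<Sum>i\<in>I. f i) b = (\<Sum>i\<in>I. coord B (f i) b)"
  using real_vector.representation_sum[of B I f] basis_simps by auto

lemma coord_unique:
  assumes "y = (\<Sum>b\<in>B. c b *\<^sub>R b)" "b \<in> B" shows "coord B y b = c b"
proof -
  have "coord B y b = (\<Sum>x\<in>B. coord B (c x *\<^sub>R x) b)"
    unfolding assms(1) by (rule coord_of_sum) (use basis_simps in \<open>auto intro: span_scale span_base\<close>)
  also have "\<dots> = (\<Sum>x\<in>B. if b = x then c x else 0)"
    by (rule sum.cong) (use basis_simps in \<open>auto simp: coord_scale coord_base span_base\<close>)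
  also have "\<dots> = c b" using assms(2) basis_simps by simp
  finally show ?thesis .
qed

lemma h_coord: assumes "y \<in> span A" shows "h y = (\<Sum>b\<in>B. coord B y b)"
proof -
  have "h y = h (\<Sum>b\<in>B. coord B y b *\<^sub>R b)" using coord_sum[OF assms] by simp
  also have "\<dots> = (\<Sum>b\<in>B. coord B y b * h b)"
    by (simp add: linear_sum[OF linear_h] linear_cmul[OF linear_h])
  also have "\<dots> = (\<Sum>b\<in>B. coord B y b)"
    by (rule sum.cong) (use basis_simps h_A in auto)
  finally show ?thesis .
qed

lemma pos_span_basis: "y \<in> pos_span B \<longleftrightarrow> y \<in> span A \<and> (\<forall>b\<in>B. 0 \<le> coord B y b)"
proof
  assume "y \<in> pos_span B"
  then obtain c where c: "\<forall>b\<in>B. 0 \<le> c b" "y = (\<Sum>b\<in>B. c b *\<^sub>R b)"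
    unfolding pos_span_def by blast
  then show "y \<in> span A \<and> (\<forall>b\<in>B. 0 \<le> coord B y b)"
    using coord_unique[OF c(2)] pos_span_subset_span[of B] \<open>y \<in> pos_span B\<close> basis_simps by auto
next
  assume "y \<in> span A \<and> (\<forall>b\<in>B. 0 \<le> coord B y b)"
  then show "y \<in> pos_span B" by (intro pos_spanI[of _ "coord B y"]) (auto simp: coord_sum)
qed

lemma coord_eqI:
  assumes "x \<in> span A" "y \<in> span A" "\<And>b. b \<in> B \<Longrightarrow> coord B x b = coord B y b"
  shows "x = y"
  using coord_sum[OF assms(1)] coord_sum[OF assms(2)] assms(3) by (metis (no_types, lifting) sum.cong)

lemma pos_span_basis_subset: "pos_span B \<subseteq> pos_span A"
  by (rule pos_span_mono) (use basis_simps finite_A in \<open>auto intro: pos_span_base\<close>)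

text \<open>Solve the expansion of \<open>a\<close> for \<open>b\<close> and substitute; the
  division explains why the \<open>b\<close>-coordinate of \<open>a\<close> must be nonzero. This is
  the exchange step of the simplex method.\<close>

lemma pivot:
  assumes a: "a \<in> A" and b: "b \<in> B" "coord B a b \<noteq> 0"
  defines "B' \<equiv> insert a (B - {b})"
  shows pivot_basis: "basis B'" and pivot_notin: "a \<notin> B - {b}"
    and pivot_sum: "\<And>z. z \<in> span A \<Longrightarrow> z = (\<Sum>c\<in>B - {b}. (coord B z c - coord B z b / coord B a b * coord B a c) *\<^sub>R c) + (coord B z b / coord B a b) *\<^sub>R a"
proof -
  show an: "a \<notin> B - {b}"
  proof
    assume "a \<in> B - {b}"
    then show False using coord_base[of a b] b by auto
  qed
  have sa: "a \<in> span A" using a by (simp add: span_base)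
  show eq: "z = (\<Sum>c\<in>B - {b}. (coord B z c - coord B z b / coord B a b * coord B a c) *\<^sub>R c) + (coord B z b / coord B a b) *\<^sub>R a"
    if z: "z \<in> span A" for z
  proof -
    define t where "t = coord B z b / coord B a b"
    have "z = (z - t *\<^sub>R a) + t *\<^sub>R a" by simp
    also have "z - t *\<^sub>R a = (\<Sum>c\<in>B. coord B z c *\<^sub>R c) - t *\<^sub>R (\<Sum>c\<in>B. coord B a c *\<^sub>R c)"
      using coord_sum z sa by simp
    also have "\<dots> = (\<Sum>c\<in>B. (coord B z c - t * coord B a c) *\<^sub>R c)"
      by (simp add: scaleR_sum_right scaleR_diff_left sum_subtractf)
    also have "\<dots> = (\<Sum>c\<in>B - {b}. (coord B z c - t * coord B a c) *\<^sub>R c)"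
      using b basis_simps by (subst sum.remove[of _ b]) (auto simp: t_def)
    finally show ?thesis unfolding t_def .
  qed
  have "a \<notin> span (B - {b})"
  proof
    assume "a \<in> span (B - {b})"
    then obtain c where "a = (\<Sum>x\<in>B - {b}. c x *\<^sub>R x)"
      using basis_simps by (auto simp: span_finite)
    then have "a = (\<Sum>x\<in>B. (if x = b then 0 else c x) *\<^sub>R x)"
      using b basis_simps by (subst sum.remove[of _ b]) (auto intro: sum.cong)
    then show False using coord_unique[of a "\<lambda>x. if x = b then 0 else c x" b] b by simp
  qed
  moreover have "independent (B - {b})"
    using basis_simps real_vector.independent_mono by blast
  ultimately have "independent B'"
    unfolding B'_def by (simp add: real_vector.independent_insertI)
  moreover have "A \<subseteq> span B'"
  proof
    fix z assume "z \<in> A"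
    then have "z \<in> span A" by (simp add: span_base)
    then show "z \<in> span B'"
      by (subst eq, simp, intro span_add span_sum span_scale span_base) (auto simp: B'_def)
  qed
  ultimately show "basis B'" unfolding basis_def B'_def using a basis_simps by auto
qed

end

lemma pivot_coord:
  assumes "basis B" and a: "a \<in> A" and b: "b \<in> B" "coord B a b \<noteq> 0" and z: "z \<in> span A"
  defines "B' \<equiv> insert a (B - {b})"
  shows "coord B' z a = coord B z b / coord B a b"
    and "c \<in> B - {b} \<Longrightarrow> coord B' z c = coord B z c - coord B z b / coord B a b * coord B a c"
proof -
  note p = pivot[OF assms(1) a b]
  let ?f = "\<lambda>c. if c = a then coord B z b / coord B a b else coord B z c - coord B z b / coord B a b * coord B a c"
  have "(\<Sum>c\<in>B'. ?f c *\<^sub>R c) = ?f a *\<^sub>R a + (\<Sum>c\<in>B - {b}. ?f c *\<^sub>R c)"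
    unfolding B'_def by (rule sum.insert) (use p(2) basis_finite[OF assms(1)] in auto)
  also have "(\<Sum>c\<in>B - {b}. ?f c *\<^sub>R c) =
      (\<Sum>c\<in>B - {b}. (coord B z c - coord B z b / coord B a b * coord B a c) *\<^sub>R c)"
    by (rule sum.cong) (use p(2) in auto)
  finally have "z = (\<Sum>c\<in>B'. ?f c *\<^sub>R c)"
    using p(3)[OF z] by (simp add: add.commute)
  note u = coord_unique[OF p(1)[folded B'_def] this]
  show "coord B' z a = coord B z b / coord B a b" using u[of a] by (simp add: B'_def)
  show "coord B' z c = coord B z c - coord B z b / coord B a b * coord B a c" if "c \<in> B - {b}"
    using u[of c] p(2) that by (auto simp: B'_def)
qed

text \<open>The coordinates of \<open>a\<close> sum to \<open>h a = 1\<close>, so one is positive.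
  Among the positive ones, the least ratio selects a leaving vertex for which no coordinate of
  \<open>z\<close> becomes negative.\<close>

lemma pivot_cone:
  assumes B: "basis B" and z: "z \<in> pos_span B" and a: "a \<in> A"
  obtains b where "b \<in> B" "coord B a b > 0" "z \<in> pos_span (insert a (B - {b}))"
proof -
  have zz: "z \<in> span A" "\<And>b. b \<in> B \<Longrightarrow> 0 \<le> coord B z b" using z pos_span_basis[OF B] by auto
  have sa: "a \<in> span A" using a by (simp add: span_base)
  define W where "W = {b \<in> B. coord B a b > 0}"
  have W: "finite W" "W \<noteq> {}"
  proof -
    show "W \<noteq> {}"
    proof
      assume "W = {}"
      then have "(\<Sum>b\<in>B. coord B a b) \<le> 0" by (intro sum_nonpos) (auto simp: W_def not_less)
      then show False using h_coord[OF B sa] h_A[OF a] by simp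
    qed
  qed (use basis_finite[OF B] W_def in auto)
  define b where "b = arg_min_on (\<lambda>b. coord B z b / coord B a b) W"
  have b: "b \<in> W" "\<And>c. c \<in> W \<Longrightarrow> coord B z b / coord B a b \<le> coord B z c / coord B a c"
    unfolding b_def using arg_min_if_finite[OF W, of "\<lambda>b. coord B z b / coord B a b"]
    by (auto simp: not_less)
  have bB: "b \<in> B" "coord B a b > 0" using b(1) by (auto simp: W_def)
  define t where "t = coord B z b / coord B a b"
  have t0: "t \<ge> 0" unfolding t_def using bB zz by auto
  note pc = pivot_coord[OF B a bB(1) _ zz(1)]
  have nn: "coord B z c - t * coord B a c \<ge> 0" if "c \<in> B" for c
  proof (cases "coord B a c > 0")
    case True
    then show ?thesis using b(2)[of c] that unfolding W_def t_def[symmetric] by (simp add: field_simps)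
  next
    case False
    then show ?thesis using t0 zz(2)[OF that] by (simp add: mult_nonneg_nonpos order_trans[of _ 0])
  qed
  have "z \<in> pos_span (insert a (B - {b}))"
    using pivot_basis[OF B a bB(1)] bB pc zz nn t0
    by (subst pos_span_basis) (auto simp: t_def)
  then show ?thesis using that bB by blast
qed

lemma cone_basis_exists:
  assumes "z \<in> pos_span A"
  obtains B where "basis B" "z \<in> pos_span B"
proof -
  obtain U where U: "U \<subseteq> A" "independent U" "z \<in> pos_span U"
    using conic_caratheodory[OF finite_A assms] by metis
  obtain B where B: "basis B" "U \<subseteq> B" using basis_extend[OF U(1,2)] by metis
  have "pos_span U \<subseteq> pos_span B"
    by (rule pos_span_mono) (use B basis_finite in \<open>auto intro: pos_span_base\<close>)
  then show ?thesis using that B U by blast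
qed

text \<open>Exchanging a vertex for a further point of the simplex strictly shrinks the set of points
  covered, so a basis cone with the fewest points is an empty simplex.\<close>

lemma empty_basis_exists:
  assumes "z \<in> pos_span A"
  obtains B where "basis B" "z \<in> pos_span B" "A \<inter> pos_span B = B"
proof -
  let ?Q = "\<lambda>B. basis B \<and> z \<in> pos_span B"
  obtain B0 where B0: "?Q B0" using cone_basis_exists[OF assms] by metis
  define B where "B = arg_min (\<lambda>B. card (A \<inter> pos_span B)) ?Q"
  have B: "basis B" "z \<in> pos_span B"
    unfolding B_def using arg_min_natI[of ?Q, OF B0] by simp_all
  have min: "card (A \<inter> pos_span B) \<le> card (A \<inter> pos_span B')" if "?Q B'" for B'
    unfolding B_def by (rule arg_min_nat_le[of ?Q, OF that])
  have BA: "B \<subseteq> A \<inter> pos_span B"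
    using B basis_finite[OF B(1)] by (auto simp: basis_def intro: pos_span_base)
  have "A \<inter> pos_span B \<subseteq> B"
  proof (rule ccontr)
    assume "\<not> A \<inter> pos_span B \<subseteq> B"
    then obtain a where a: "a \<in> A" "a \<in> pos_span B" "a \<notin> B" by blast
    obtain b where b: "b \<in> B" "coord B a b > 0" "z \<in> pos_span (insert a (B - {b}))"
      using pivot_cone[OF B a(1)] by metis
    define B' where "B' = insert a (B - {b})"
    have B': "basis B'" unfolding B'_def using pivot_basis[OF B(1) a(1) b(1)] b by auto
    have sub: "pos_span B' \<subseteq> pos_span B"
      by (rule pos_span_mono) (use BA a basis_finite[OF B(1)] in \<open>auto simp: B'_def\<close>)
    have "b \<notin> pos_span B'"
    proof
      assume bp: "b \<in> pos_span B'"
      have sb: "b \<in> span A" using BA b(1) by (auto intro: span_base)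
      note pc = pivot_coord[OF B(1) a(1) b(1) _ sb, folded B'_def]
      \<comment> \<open>At the common vertices, the new coordinates of \<open>b\<close> have the
        opposite sign to the old coordinates of \<open>a\<close>. Both being nonnegative they
        vanish, and the height then forces \<open>a = b\<close>.\<close>
      have cb: "coord B' b a = 1 / coord B a b"
        "\<And>c. c \<in> B - {b} \<Longrightarrow> coord B' b c = - coord B a c / coord B a b"
        using pc b coord_base[OF B(1) b(1)] by auto
      have "coord B a c = 0" if c: "c \<in> B - {b}" for c
      proof -
        have "0 \<le> coord B' b c" using bp B' c by (auto simp: pos_span_basis B'_def)
        moreover have "0 \<le> coord B a c" using a(2) c by (auto simp: pos_span_basis[OF B(1)])
        ultimately show ?thesis using cb(2)[OF c] b(2) by (auto simp: field_simps)
      qed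
      moreover have "coord B a b = 1"
        using h_coord[OF B(1), of a] a h_A[OF a(1)] b(1) calculation basis_finite[OF B(1)]
        by (simp add: span_base sum.remove[of B b])
      ultimately have "a = b"
        by (intro coord_eqI[OF B(1)]) (use a sb coord_base[OF B(1) b(1)] in \<open>auto intro: span_base\<close>)
      then show False using a b by simp
    qed
    then have "A \<inter> pos_span B' \<subset> A \<inter> pos_span B" using sub BA b(1) by auto
    then have "card (A \<inter> pos_span B') < card (A \<inter> pos_span B)"
      by (intro psubset_card_mono) (auto simp: finite_A)
    then show False using min[of B'] B' b(3) unfolding B'_def by auto
  qed
  then show ?thesis using that B BA by blast
qed

end

section \<open>Regular triangulations and half-open decompositions\<close>

text \<open>Meets finitely many genericity conditions with one parameter: the product of the
  polynomials has only finitely many roots.\<close>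

lemma exists_pos_nonroot:
  fixes p :: "'i \<Rightarrow> real poly"
  assumes "finite I" "\<And>i. i \<in> I \<Longrightarrow> p i \<noteq> 0"
  obtains x where "x > 0" "\<And>i. i \<in> I \<Longrightarrow> poly (p i) x \<noteq> 0"
proof -
  have "(\<Prod>i\<in>I. p i) \<noteq> 0" using assms by auto
  then have "finite {x. poly (\<Prod>i\<in>I. p i) x = 0}" by (rule poly_roots_finite)
  moreover have "infinite {0::real<..}" by (simp add: infinite_Ioi)
  ultimately obtain x where "x \<in> {0<..}" "poly (\<Prod>i\<in>I. p i) x \<noteq> 0"
    by (metis (mono_tags, lifting) finite_subset mem_Collect_eq subsetI)
  then show ?thesis using that assms(1) by (auto simp: poly_prod)
qed

text \<open>For small positive \<open>e\<close> the sign is the lexicographic sign of the pair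
  \<open>(u, v)\<close>; this is the origin of the weak and strict inequalities in
  \<open>halfopen_cone\<close>.\<close>

lemma eventually_sign_perturbation:
  fixes u v :: real
  assumes "v \<noteq> 0"
  shows "\<forall>\<^sub>F e in at_right 0. (0 < u + e * v \<longleftrightarrow> (if 0 < v then 0 \<le> u else 0 < u)) \<and> u + e * v \<noteq> 0"
proof -
  have lim: "((\<lambda>e. u + e * v) \<longlongrightarrow> u + 0 * v) (at_right 0)"
    by (intro tendsto_intros)
  have pos: "\<forall>\<^sub>F e in at_right 0. 0 < (e::real)" by (rule eventually_at_right_less)
  consider "u = 0" | "u > 0" | "u < 0" by linarith
  then show ?thesis
  proof cases
    case 1
    show ?thesis using pos by eventually_elim (use 1 assms in \<open>auto simp: zero_less_mult_iff\<close>)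
  next
    case 2
    then have "\<forall>\<^sub>F e in at_right 0. 0 < u + e * v" using order_tendstoD(1)[OF lim, of 0] by simp
    then show ?thesis by eventually_elim (use 2 in auto)
  next
    case 3
    then have "\<forall>\<^sub>F e in at_right 0. u + e * v < 0" using order_tendstoD(2)[OF lim, of 0] by simp
    then show ?thesis by eventually_elim (use 3 in auto)
  qed
qed

context graded_points
begin

text \<open>Height at \<open>y\<close> of the hyperplane through the lifted vertices of
  \<open>B\<close>.\<close>

definition weight :: "('e \<Rightarrow> real) \<Rightarrow> 'e set \<Rightarrow> 'e \<Rightarrow> real" where
  "weight w B y = (\<Sum>b\<in>B. coord B y b * w b)"

text \<open>The regular triangulation induced by the heights \<open>w\<close>: a basis \<open>B\<close> spans a maximal cell iff
  the linear functional interpolating \<open>w\<close> on \<open>B\<close> lies strictly below \<open>w\<close> at all other points.\<close>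

definition triang :: "('e \<Rightarrow> real) \<Rightarrow> 'e set set" where
  "triang w = {B. basis B \<and> (\<forall>a\<in>A - B. weight w B a < w a)}"

text \<open>No further lifted point lies on a hyperplane through a lifted basis, so a point that is
  not strictly above lies strictly below.\<close>

definition generic_weight :: "('e \<Rightarrow> real) \<Rightarrow> bool" where
  "generic_weight w \<longleftrightarrow> (\<forall>B a. basis B \<longrightarrow> a \<in> A - B \<longrightarrow> weight w B a \<noteq> w a)"

text \<open>The point avoids every hyperplane spanned by a facet of a simplex.\<close>

definition generic_point :: "'e \<Rightarrow> bool" where
  "generic_point z \<longleftrightarrow> z \<in> span A \<and> (\<forall>B b. basis B \<longrightarrow> b \<in> B \<longrightarrow> coord B z b \<noteq> 0)"

lemma triang_basis: "B \<in> triang w \<Longrightarrow> basis B"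
  unfolding triang_def by simp

lemma finite_triang: "finite (triang w)"
  by (rule finite_subset[OF _ finite_bases]) (auto simp: triang_def)

lemma weight_base:
  assumes "basis B" "b \<in> B" shows "weight w B b = w b"
proof -
  have "weight w B b = (\<Sum>x\<in>B. if x = b then w x else 0)"
    unfolding weight_def by (rule sum.cong) (use coord_base[OF assms] in auto)
  then show ?thesis using assms basis_finite by simp
qed

text \<open>Linearity of \<open>weight w B\<close>, evaluated in the coordinates of another basis so
  that two interpolating functionals can be compared at one point.\<close>

lemma weight_expand:
  assumes B: "basis B" and C: "basis C" and z: "z \<in> span A"
  shows "weight w B z = (\<Sum>c\<in>C. coord C z c * weight w B c)"
proof -
  have cC: "c \<in> span A" if "c \<in> C" for c using that C by (auto simp: basis_def intro: span_base)
  have "coord B z b = (\<Sum>c\<in>C. coord C z c * coord B c b)" for b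
  proof -
    have "coord B z b = coord B (\<Sum>c\<in>C. coord C z c *\<^sub>R c) b" using coord_sum[OF C z] by simp
    also have "\<dots> = (\<Sum>c\<in>C. coord B (coord C z c *\<^sub>R c) b)"
      by (rule coord_of_sum[OF B]) (use cC in \<open>auto intro: span_scale\<close>)
    also have "\<dots> = (\<Sum>c\<in>C. coord C z c * coord B c b)"
      by (rule sum.cong) (use cC coord_scale[OF B] in auto)
    finally show ?thesis .
  qed
  then have "weight w B z = (\<Sum>b\<in>B. \<Sum>c\<in>C. coord C z c * coord B c b * w b)"
    unfolding weight_def by (simp add: sum_distrib_right)
  also have "\<dots> = (\<Sum>c\<in>C. \<Sum>b\<in>B. coord C z c * coord B c b * w b)" by (rule sum.swap)
  finally show ?thesis unfolding weight_def by (simp add: sum_distrib_left mult.assoc)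
qed

text \<open>The functional of a cell lies below \<open>w\<close> at all vertices of
  \<open>C\<close>, and strictly below at one outside \<open>B\<close>; the positive coordinates of
  \<open>z\<close> preserve this.\<close>

lemma weight_triang_less:
  assumes B: "B \<in> triang w" and C: "basis C" and z: "z \<in> span A" "\<And>c. c \<in> C \<Longrightarrow> 0 < coord C z c"
    and ne: "C - B \<noteq> {}"
  shows "weight w B z < weight w C z"
proof -
  have bB: "basis B" using B triang_basis by blast
  have le: "weight w B c \<le> w c" if "c \<in> C" for c
  proof (cases "c \<in> B")
    case False
    then have "c \<in> A - B" using that C by (auto simp: basis_def)
    then show ?thesis using B by (simp add: triang_def less_imp_le)
  qed (use weight_base[OF bB] in simp)
  obtain c where c: "c \<in> C" "c \<notin> B" using ne by blast
  then have lt: "weight w B c < w c" using B C by (auto simp: triang_def basis_def)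
  show ?thesis
    unfolding weight_expand[OF bB C z(1)] weight_def[of w C]
  proof (rule sum_strict_mono_ex1)
    show "finite C" using basis_finite[OF C] .
    show "\<forall>c\<in>C. coord C z c * weight w B c \<le> coord C z c * w c"
      using le z(2) by (simp add: less_imp_le mult_left_mono)
    show "\<exists>c\<in>C. coord C z c * weight w B c < coord C z c * w c"
      using c lt z(2) by auto
  qed
qed

text \<open>Different bases of equal size each have a vertex outside the other, so two cells around
  \<open>z\<close> would each have the smaller weight there.\<close>

lemma triang_unique:
  assumes B: "B \<in> triang w" and C: "C \<in> triang w" and z: "z \<in> span A"
    "\<And>b. b \<in> B \<Longrightarrow> 0 < coord B z b" "\<And>c. c \<in> C \<Longrightarrow> 0 < coord C z c"
  shows "B = C"
proof (rule ccontr)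
  assume ne: "B \<noteq> C"
  have b: "basis B" "basis C" using B C triang_basis by auto
  have "card B = card C" "finite B" "finite C" using b basis_card basis_finite by auto
  then have "C - B \<noteq> {}" "B - C \<noteq> {}" using ne card_subset_eq by (metis Diff_eq_empty_iff)+
  then show False
    using weight_triang_less[OF B b(2) z(1) z(3)] weight_triang_less[OF C b(1) z(1) z(2)] by force
qed

text \<open>Linear programming: among the simplices whose cones contain \<open>z\<close>, one of
  least weight is a cell, because a lifted point below its hyperplane could be pivoted in at a
  gain.\<close>

lemma triang_cover:
  assumes z: "z \<in> pos_span A" "generic_point z" and w: "generic_weight w"
  obtains B where "B \<in> triang w" "\<And>b. b \<in> B \<Longrightarrow> 0 < coord B z b"
proof -
  define Q where "Q = {B. basis B \<and> z \<in> pos_span B}"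
  have Q: "finite Q" "Q \<noteq> {}"
    using finite_bases cone_basis_exists[OF z(1)] unfolding Q_def by auto
  define B where "B = arg_min_on (\<lambda>B. weight w B z) Q"
  have "B \<in> Q" and min: "\<And>C. C \<in> Q \<Longrightarrow> weight w B z \<le> weight w C z"
    unfolding B_def using arg_min_if_finite[OF Q, of "\<lambda>B. weight w B z"] by (auto simp: not_less)
  then have B: "basis B" "z \<in> pos_span B" by (auto simp: Q_def)
  have zs: "z \<in> span A" using z(2) by (simp add: generic_point_def)
  have pos: "0 < coord B z b" if "b \<in> B" for b
    using that B z(2) by (force simp: generic_point_def pos_span_basis[OF B(1)])
  have "weight w B a < w a" if a: "a \<in> A - B" for a
  proof (rule ccontr)
    assume "\<not> weight w B a < w a"
    then have gt: "weight w B a > w a" using w a B(1) by (force simp: generic_weight_def)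
    have aA: "a \<in> A" using a by simp
    obtain b where b: "b \<in> B" "coord B a b > 0" "z \<in> pos_span (insert a (B - {b}))"
      using pivot_cone[OF B aA] by metis
    have b0: "coord B a b \<noteq> 0" using b by simp
    define C where "C = insert a (B - {b})"
    have C: "basis C" unfolding C_def by (rule pivot_basis[OF B(1) aA b(1) b0])
    define t where "t = coord B z b / coord B a b"
    have t: "t > 0" unfolding t_def using pos[OF b(1)] b(2) by simp
    note pc = pivot_coord[OF B(1) aA b(1) b0 zs, folded C_def t_def]
    have fB: "finite B" using basis_finite B(1) by blast
    have "weight w C z = t * w a + (\<Sum>c\<in>B - {b}. coord C z c * w c)"
      unfolding weight_def C_def
      by (subst sum.insert) (use fB a pc(1) in \<open>auto simp: C_def\<close>)
    also have "(\<Sum>c\<in>B - {b}. coord C z c * w c) = (\<Sum>c\<in>B - {b}. (coord B z c - t * coord B a c) * w c)"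
      by (rule sum.cong) (use pc(2) in auto)
    also have "\<dots> = (\<Sum>c\<in>B. (coord B z c - t * coord B a c) * w c)"
      using fB b by (subst sum.remove[of B b]) (auto simp: t_def)
    also have "\<dots> = weight w B z - t * weight w B a"
      unfolding weight_def by (simp add: algebra_simps sum_subtractf sum_distrib_left)
    \<comment> \<open>The gain is the step length \<open>t\<close> times the reduced cost of
      \<open>a\<close>; \<open>t\<close> is positive because \<open>z\<close> is generic.\<close>
    finally have "weight w C z = weight w B z - t * (weight w B a - w a)" by (simp add: algebra_simps)
    moreover have "t * (weight w B a - w a) > 0" using t gt by simp
    ultimately have "weight w C z < weight w B z" by linarith
    then show False using min[of C] C b(3) by (simp add: Q_def C_def)
  qed
  then show ?thesis using that[of B] B(1) pos by (simp add: triang_def)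
qed

text \<open>Heights vanishing on \<open>S\<close> and equal to distinct powers of a number \<open>x\<close> elsewhere: each genericity condition excludes only the roots of a nonzero polynomial.\<close>

lemma generic_weight_exists:
  assumes S: "basis S"
  obtains w where "generic_weight w" "S \<in> triang w"
proof -
  obtain idx :: "'e \<Rightarrow> nat" where idx: "inj_on idx A"
    using finite_imp_inj_to_nat_seg[OF finite_A] by blast
  define w where "w x a = (if a \<in> S then 0 else x ^ idx a)" for x :: real and a
  \<comment> \<open>As a polynomial in \<open>x\<close>, the signed distance from the lifted
    \<open>a\<close> to the hyperplane of \<open>B\<close>; vertices in \<open>S\<close> contribute
    nothing, their height being 0.\<close>
  define p where "p B a = (if a \<in> S then 0 else monom 1 (idx a)) - (\<Sum>b\<in>B - S. monom (coord B a b) (idx b))" for B a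
  have poly_p: "poly (p B a) x = w x a - weight (w x) B a" if "basis B" for B a x
  proof -
    have "weight (w x) B a = (\<Sum>b\<in>B - S. coord B a b * x ^ idx b)"
      unfolding weight_def w_def using basis_finite[OF that]
      by (intro sum.mono_neutral_cong_right) auto
    then show ?thesis by (simp add: p_def w_def poly_sum poly_monom)
  qed
  have p_nz: "p B a \<noteq> 0" if B: "basis B" and a: "a \<in> A - B" for B a
  proof
    assume p0: "p B a = 0"
    have BA: "B \<subseteq> A" using B by (simp add: basis_def)
    have fB: "finite (B - S)" using basis_finite[OF B] by simp
    show False
    proof (cases "a \<in> S")
      case False
      have "coeff (p B a) (idx a) = 1 - (\<Sum>b\<in>B - S. if idx b = idx a then coord B a b else 0)"
        using False by (simp add: p_def coeff_sum)
      also have "(\<Sum>b\<in>B - S. if idx b = idx a then coord B a b else 0) = 0"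
        by (rule sum.neutral) (use a BA inj_onD[OF idx] in fastforce)
      finally show False using p0 by simp
    next
      case True
      have z: "coord B a b = 0" if b: "b \<in> B - S" for b
      proof -
        have "coeff (p B a) (idx b) = - (\<Sum>c\<in>B - S. if idx c = idx b then coord B a c else 0)"
          using True by (simp add: p_def coeff_sum)
        also have "(\<Sum>c\<in>B - S. if idx c = idx b then coord B a c else 0) = (\<Sum>c\<in>B - S. if c = b then coord B a c else 0)"
          by (rule sum.cong) (use b BA inj_onD[OF idx] in fastforce)+
        also have "\<dots> = coord B a b" using b fB by simp
        finally show ?thesis using p0 by simp
      qed
      \<comment> \<open>Now \<open>a\<close> is a combination of vertices in
        \<open>B \<inter> S\<close>. As \<open>a\<close> lies in \<open>S\<close> but not in
        \<open>B\<close>, this contradicts uniqueness of coordinates over \<open>S\<close>.\<close>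
      have "a = (\<Sum>b\<in>B. coord B a b *\<^sub>R b)" using coord_sum[OF B, of a] a by (simp add: span_base)
      also have "\<dots> = (\<Sum>b\<in>B \<inter> S. coord B a b *\<^sub>R b)"
        using z basis_finite[OF B] by (intro sum.mono_neutral_right) auto
      also have "\<dots> = (\<Sum>b\<in>S. (if b \<in> B then coord B a b else 0) *\<^sub>R b)"
        using basis_finite[OF S] by (intro sum.mono_neutral_cong_left) auto
      finally have "coord S a a = (if a \<in> B then coord B a a else 0)"
        using coord_unique[OF S, of a "\<lambda>b. if b \<in> B then coord B a b else 0" a] True by simp
      then show False using a coord_base[OF S True, of a] by simp
    qed
  qed
  have "finite {(B, a). basis B \<and> a \<in> A - B}"
    by (rule finite_subset[of _ "{B. basis B} \<times> A"]) (auto simp: finite_bases finite_A)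
  then obtain x where x: "x > 0"
    "\<And>i. i \<in> {(B, a). basis B \<and> a \<in> A - B} \<Longrightarrow> poly (case i of (B, a) \<Rightarrow> p B a) x \<noteq> 0"
    by (rule exists_pos_nonroot[where p = "\<lambda>(B, a). p B a"]) (use p_nz in auto)
  have nr: "poly (p B a) x \<noteq> 0" if "basis B" "a \<in> A - B" for B a
    using x(2)[of "(B, a)"] that by simp
  have "generic_weight (w x)"
    unfolding generic_weight_def using nr poly_p by force
  moreover have "weight (w x) S a = 0" for a unfolding weight_def by (simp add: w_def)
  then have "S \<in> triang (w x)"
    using S x(1) by (simp add: triang_def w_def)
  ultimately show ?thesis using that by blast
qed

text \<open>Powers of \<open>x\<close> serve as coordinates over \<open>S\<close>, positive for
  \<open>x > 0\<close>. A coordinate over \<open>B\<close> is then a polynomial in \<open>x\<close>;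
  were it zero, that coordinate would vanish on \<open>S\<close>, hence on the whole span and on
  \<open>b\<close> itself.\<close>

lemma generic_point_exists:
  assumes S: "basis S"
  obtains q where "generic_point q" "\<And>s. s \<in> S \<Longrightarrow> 0 < coord S q s"
proof -
  obtain idx :: "'e \<Rightarrow> nat" where idx: "inj_on idx A"
    using finite_imp_inj_to_nat_seg[OF finite_A] by blast
  have SA: "S \<subseteq> A" and fS: "finite S" using S basis_finite by (auto simp: basis_def)
  have sS: "s \<in> span A" if "s \<in> S" for s using that SA by (auto intro: span_base)
  define q where "q x = (\<Sum>s\<in>S. x ^ idx s *\<^sub>R s)" for x :: real
  define p where "p B b = (\<Sum>s\<in>S. monom (coord B s b) (idx s))" for B b
  have q_span: "q x \<in> span A" for x
    unfolding q_def by (intro span_sum span_scale) (use sS in auto)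
  have poly_p: "poly (p B b) x = coord B (q x) b" if B: "basis B" for B b x
  proof -
    have "coord B (q x) b = (\<Sum>s\<in>S. coord B (x ^ idx s *\<^sub>R s) b)"
      unfolding q_def by (rule coord_of_sum[OF B]) (use sS in \<open>auto intro: span_scale\<close>)
    also have "\<dots> = (\<Sum>s\<in>S. coord B s b * x ^ idx s)"
      by (rule sum.cong) (use sS coord_scale[OF B] in auto)
    finally show ?thesis by (simp add: p_def poly_sum poly_monom)
  qed
  have p_nz: "p B b \<noteq> 0" if B: "basis B" and b: "b \<in> B" for B b
  proof
    assume p0: "p B b = 0"
    have z: "coord B s b = 0" if s: "s \<in> S" for s
    proof -
      have "coeff (p B b) (idx s) = (\<Sum>c\<in>S. if idx c = idx s then coord B c b else 0)"
        by (simp add: p_def coeff_sum)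
      also have "\<dots> = (\<Sum>c\<in>S. if c = s then coord B c b else 0)"
        by (rule sum.cong) (use s SA inj_onD[OF idx] in fastforce)+
      also have "\<dots> = coord B s b" using s fS by simp
      finally show ?thesis using p0 by simp
    qed
    have bs: "b \<in> span A" using b B by (auto simp: basis_def intro: span_base)
    have "coord B b b = coord B (\<Sum>s\<in>S. coord S b s *\<^sub>R s) b" using coord_sum[OF S bs] by simp
    also have "\<dots> = (\<Sum>s\<in>S. coord B (coord S b s *\<^sub>R s) b)"
      by (rule coord_of_sum[OF B]) (use sS in \<open>auto intro: span_scale\<close>)
    also have "\<dots> = 0"
      by (rule sum.neutral) (use sS coord_scale[OF B] z in auto)
    finally show False using coord_base[OF B b, of b] by simp
  qed
  have "finite {(B, b). basis B \<and> b \<in> B}"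
    by (rule finite_subset[of _ "{B. basis B} \<times> A"]) (auto simp: finite_bases finite_A basis_def)
  then obtain x where x: "x > 0"
    "\<And>i. i \<in> {(B, b). basis B \<and> b \<in> B} \<Longrightarrow> poly (case i of (B, b) \<Rightarrow> p B b) x \<noteq> 0"
    by (rule exists_pos_nonroot[where p = "\<lambda>(B, b). p B b"]) (use p_nz in auto)
  have nr: "poly (p B b) x \<noteq> 0" if "basis B" "b \<in> B" for B b
    using x(2)[of "(B, b)"] that by simp
  have "generic_point (q x)"
    unfolding generic_point_def using nr poly_p q_span by force
  moreover have "coord S (q x) s = x ^ idx s" if "s \<in> S" for s
    by (rule coord_unique[OF S _ that]) (simp add: q_def)
  ultimately show ?thesis using that[of "q x"] x(1) by simp
qed

text \<open>The facet opposite \<open>b\<close> is kept exactly when \<open>q\<close> lies on the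
  same side of it as \<open>b\<close>; genericity of \<open>q\<close> rules out ties.\<close>

definition halfopen_cone :: "'e \<Rightarrow> 'e set \<Rightarrow> 'e set" where
  "halfopen_cone q B = {y \<in> span A. \<forall>b\<in>B. if 0 < coord B q b then 0 \<le> coord B y b else 0 < coord B y b}"

lemma halfopen_cone_subset:
  assumes "basis B" shows "halfopen_cone q B \<subseteq> pos_span A"
proof -
  have "halfopen_cone q B \<subseteq> pos_span B"
    by (auto simp: halfopen_cone_def pos_span_basis[OF assms] split: if_splits)
       (meson less_imp_le)
  then show ?thesis using pos_span_basis_subset[OF assms] by blast
qed

text \<open>Moving \<open>y\<close> slightly towards the generic point \<open>q\<close> puts it into the interior of exactly one
  cell; the sign of the perturbed coordinate decides which facets are open.\<close>

lemma halfopen_partition: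
  assumes w: "generic_weight w" and q: "generic_point q" "q \<in> pos_span A" and y: "y \<in> pos_span A"
  shows "\<exists>!B. B \<in> triang w \<and> y \<in> halfopen_cone q B"
proof -
  have ys: "y \<in> span A" and qs: "q \<in> span A"
    using y q pos_span_subset_span by auto
  \<comment> \<open>One \<open>e\<close> serves all bases because there are finitely many. The
    clause with \<noteq> 0 makes the moved point generic again.\<close>
  have "\<forall>\<^sub>F e in at_right 0. \<forall>B\<in>{B. basis B}. \<forall>b\<in>B.
     (0 < coord B y b + e * coord B q b \<longleftrightarrow> (if 0 < coord B q b then 0 \<le> coord B y b else 0 < coord B y b)) \<and>
      coord B y b + e * coord B q b \<noteq> 0"
  proof (rule eventually_ball_finite[OF finite_bases], rule ballI)
    fix B assume "B \<in> {B. basis B}"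
    then have B: "basis B" by simp
    show "\<forall>\<^sub>F e in at_right 0. \<forall>b\<in>B.
     (0 < coord B y b + e * coord B q b \<longleftrightarrow> (if 0 < coord B q b then 0 \<le> coord B y b else 0 < coord B y b)) \<and>
      coord B y b + e * coord B q b \<noteq> 0"
      by (rule eventually_ball_finite[OF basis_finite[OF B]], rule ballI, rule eventually_sign_perturbation)
         (use q(1) B in \<open>auto simp: generic_point_def\<close>)
  qed
  moreover have "\<forall>\<^sub>F e in at_right 0. 0 < (e::real)" by (rule eventually_at_right_less)
  ultimately have "\<forall>\<^sub>F e in at_right 0. 0 < e \<and> (\<forall>B\<in>{B. basis B}. \<forall>b\<in>B.
     (0 < coord B y b + e * coord B q b \<longleftrightarrow> (if 0 < coord B q b then 0 \<le> coord B y b else 0 < coord B y b)) \<and>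
      coord B y b + e * coord B q b \<noteq> 0)"
    by eventually_elim simp
  from eventually_happens'[OF trivial_limit_at_right_real this] obtain e where e: "0 < e" and
    sgn: "\<And>B b. basis B \<Longrightarrow> b \<in> B \<Longrightarrow>
     (0 < coord B y b + e * coord B q b \<longleftrightarrow> (if 0 < coord B q b then 0 \<le> coord B y b else 0 < coord B y b)) \<and>
      coord B y b + e * coord B q b \<noteq> 0"
    by blast
  define z where "z = y + e *\<^sub>R q"
  have cz: "coord B z b = coord B y b + e * coord B q b" if "basis B" for B b
    unfolding z_def using coord_add[OF that ys] coord_scale[OF that qs] qs by (simp add: span_scale)
  have z: "z \<in> pos_span A" "z \<in> span A"
    unfolding z_def using y q(2) e ys qs
    by (auto intro!: pos_span_add pos_span_scale span_add intro: span_scale)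
  have gz: "generic_point z"
    unfolding generic_point_def using z(2) sgn cz by simp
  have iff: "y \<in> halfopen_cone q B \<longleftrightarrow> (\<forall>b\<in>B. 0 < coord B z b)" if "basis B" for B
    unfolding halfopen_cone_def using ys sgn[OF that] cz[OF that] by simp
  obtain B where B: "B \<in> triang w" "\<And>b. b \<in> B \<Longrightarrow> 0 < coord B z b"
    using triang_cover[OF z(1) gz w] by metis
  show ?thesis
  proof (rule ex1I[of _ B])
    show "B \<in> triang w \<and> y \<in> halfopen_cone q B" using B iff triang_basis by blast
    fix C assume C: "C \<in> triang w \<and> y \<in> halfopen_cone q C"
    then have "\<forall>b\<in>C. 0 < coord C z b" using iff triang_basis by blast
    then show "C = B" using triang_unique[of C w B z] C B z(2) by blast
  qed
qed

end

section \<open>Generating functions of half-open cones and the Ehrhart numerator\<close>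

locale graded_lattice_cone = graded_points A h for A :: "'e::real_vector set" and h +
  fixes L :: "'e set"
  assumes L_add: "\<And>x y. x \<in> L \<Longrightarrow> y \<in> L \<Longrightarrow> x + y \<in> L"
    and L_diff: "\<And>x y. x \<in> L \<Longrightarrow> y \<in> L \<Longrightarrow> x - y \<in> L"
    and L_0: "0 \<in> L"
    and A_L: "A \<subseteq> L"
    and A_nonempty: "A \<noteq> {}"
    and h_int: "\<And>y. y \<in> L \<Longrightarrow> h y \<in> \<int>"
    and finite_degree: "\<And>t. finite {y \<in> pos_span A \<inter> L. h y = t}"
    and degree_1: "\<And>y. y \<in> pos_span A \<Longrightarrow> y \<in> L \<Longrightarrow> h y = 1 \<Longrightarrow> y \<in> A"
begin

text \<open>Interpolates between the lattice points of the half-open cone (\<open>D = {}\<close>)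
  and those of its half-open box (\<open>D = B\<close>). In the directions of \<open>D\<close> the
  range is [0,1) or (0,1], so that its integer translates tile the cone.\<close>

definition cell :: "'e \<Rightarrow> 'e set \<Rightarrow> 'e set \<Rightarrow> 'e set" where
  "cell q B D = {y \<in> halfopen_cone q B \<inter> L.
     \<forall>b\<in>B \<inter> D. if 0 < coord B q b then coord B y b < 1 else coord B y b \<le> 1}"

definition cell_series :: "'e \<Rightarrow> 'e set \<Rightarrow> 'e set \<Rightarrow> int fps" where
  "cell_series q B D = Abs_fps (\<lambda>n. int (card {y \<in> cell q B D. h y = real n}))"

lemma h_add: "h (x + y) = h x + h y"
  using linear_add[OF linear_h] by blast

lemma h_nonneg: assumes "y \<in> pos_span A" shows "0 \<le> h y"
proof -
  obtain c where c: "\<forall>a\<in>A. 0 \<le> c a" "y = (\<Sum>a\<in>A. c a *\<^sub>R a)"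
    using assms unfolding pos_span_def by blast
  show ?thesis unfolding c(2)
    by (simp add: linear_sum[OF linear_h] linear_cmul[OF linear_h]) (use c(1) h_A in \<open>auto intro: sum_nonneg\<close>)
qed

lemma cell_subset: "basis B \<Longrightarrow> cell q B D \<subseteq> pos_span A \<inter> L"
  using halfopen_cone_subset by (auto simp: cell_def)

lemma finite_cell_degree:
  assumes "basis B" shows "finite {y \<in> cell q B D. h y = t}"
  by (rule finite_subset[OF _ finite_degree[of t]]) (use cell_subset[OF assms] in auto)

text \<open>Adding \<open>b\<close> raises only the \<open>b\<close>-coordinate, by 1, so the lower
  bound for \<open>y\<close> becomes the violated upper bound for \<open>y + b\<close>.\<close>

lemma cell_shift:
  assumes B: "basis B" and b: "b \<in> B" "b \<notin> D" and y: "y \<in> span A"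
  shows "y + b \<in> cell q B D - cell q B (insert b D) \<longleftrightarrow> y \<in> cell q B D"
proof -
  have bs: "b \<in> span A" "b \<in> L" using b B A_L by (auto simp: basis_def intro: span_base)
  have ybs: "y + b \<in> span A" using y bs span_add by blast
  have L: "y + b \<in> L \<longleftrightarrow> y \<in> L" using L_add[of y b] L_diff[of "y + b" b] bs by auto
  have c: "coord B (y + b) c = coord B y c + (if c = b then 1 else 0)" for c
    using coord_add[OF B y bs(1)] coord_base[OF B b(1)] by simp
  have 1: "y + b \<in> cell q B D - cell q B (insert b D) \<longleftrightarrow>
    y + b \<in> cell q B D \<and> (if 0 < coord B q b then 1 \<le> coord B (y + b) b else 1 < coord B (y + b) b)"
    using b by (auto simp: cell_def)
  have split: "B = insert b (B - {b})" "B \<inter> D = (B - {b}) \<inter> D" using b by auto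
  have 2: "y + b \<in> cell q B D \<longleftrightarrow> y \<in> L \<and> (if 0 < coord B q b then 0 \<le> coord B y b + 1 else 0 < coord B y b + 1)
     \<and> (\<forall>b\<in>B - {b}. if 0 < coord B q b then 0 \<le> coord B y b else 0 < coord B y b)
     \<and> (\<forall>b\<in>(B - {b}) \<inter> D. if 0 < coord B q b then coord B y b < 1 else coord B y b \<le> 1)"
    unfolding cell_def halfopen_cone_def using L ybs b(1)
    by (simp add: c split(2)) (subst split(1), auto simp: c)
  have 3: "y \<in> cell q B D \<longleftrightarrow> y \<in> L \<and> (if 0 < coord B q b then 0 \<le> coord B y b else 0 < coord B y b)
     \<and> (\<forall>b\<in>B - {b}. if 0 < coord B q b then 0 \<le> coord B y b else 0 < coord B y b)
     \<and> (\<forall>b\<in>(B - {b}) \<inter> D. if 0 < coord B q b then coord B y b < 1 else coord B y b \<le> 1)"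
    unfolding cell_def halfopen_cone_def using y b(1)
    by (simp add: split(2)) (subst split(1), auto)
  show ?thesis unfolding 1 2 3 by (auto simp: c)
qed

text \<open>The cell is the disjoint union of its truncation and its own translate by
  \<open>b\<close>, which has degree 1. So the truncated series is the full series minus
  \<open>fps_X\<close> times it.\<close>

lemma cell_series_step:
  assumes B: "basis B" and b: "b \<in> B" "b \<notin> D"
  shows "cell_series q B (insert b D) = (1 - fps_X) * cell_series q B D"
proof -
  have bs: "b \<in> span A" "h b = 1" using b B h_A by (auto simp: basis_def intro: span_base)
  let ?C = "\<lambda>D n. {y \<in> cell q B D. h y = n}"
  have sub: "cell q B (insert b D) \<subseteq> cell q B D" by (auto simp: cell_def)
  have csp: "cell q B D \<subseteq> span A" by (auto simp: cell_def halfopen_cone_def)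
  have eq: "?C D n = ?C (insert b D) n \<union> (\<lambda>y. y + b) ` ?C D (n - 1)" (is "_ = ?R") for n
  proof
    show "?C D n \<subseteq> ?R"
    proof
      fix y assume y: "y \<in> ?C D n"
      show "y \<in> ?R"
      proof (cases "y \<in> cell q B (insert b D)")
        case False
        have "y - b \<in> span A" using y csp bs by (auto intro: span_diff)
        then have "y - b \<in> cell q B D" using cell_shift[OF B b, of "y - b" q] y False by simp
        moreover have "h (y - b) = n - 1" using y bs linear_diff[OF linear_h] by simp
        ultimately show ?thesis by (intro UnI2 image_eqI[of _ _ "y - b"]) auto
      qed (use y in auto)
    qed
    show "?R \<subseteq> ?C D n" using sub csp cell_shift[OF B b, of _ q] bs h_add by auto
  qed
  have disj: "?C (insert b D) n \<inter> (\<lambda>y. y + b) ` ?C D (n - 1) = {}" for n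
    using cell_shift[OF B b, of _ q] csp by auto
  have card: "card (?C D n) = card (?C (insert b D) n) + card (?C D (n - 1))" for n
    by (subst eq, subst card_Un_disjoint)
       (use disj finite_cell_degree[OF B] in \<open>auto simp: card_image\<close>)
  \<comment> \<open>At degree 0 the recursion refers to degree -1; indexing the slices by reals
    makes sense of it.\<close>
  have neg: "?C D (- 1) = {}" using cell_subset[OF B] h_nonneg by force
  show ?thesis
  proof (rule fps_ext)
    fix n
    show "fps_nth (cell_series q B (insert b D)) n = fps_nth ((1 - fps_X) * cell_series q B D) n"
      using card[of "real n"] neg
      by (cases n) (auto simp: cell_series_def algebra_simps)
  qed
qed

lemma cell_series_power:
  assumes B: "basis B" and "D \<subseteq> B"
  shows "cell_series q B D = (1 - fps_X) ^ card D * cell_series q B {}"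
proof -
  have "finite D" using assms basis_finite finite_subset by blast
  then show ?thesis using assms(2)
    by (induction D rule: finite_induct) (auto simp: cell_series_step[OF B] mult.assoc)
qed

definition ehrhart :: "nat \<Rightarrow> int" where
  "ehrhart n = int (card {y \<in> pos_span A \<inter> L. h y = real n})"

lemma ehrhart_decomposition:
  assumes w: "generic_weight w" and q: "generic_point q" "q \<in> pos_span A"
  shows "Abs_fps ehrhart = (\<Sum>B\<in>triang w. cell_series q B {})"
proof (rule fps_ext)
  fix n
  note part = halfopen_partition[OF w q]
  have eq: "{y \<in> pos_span A \<inter> L. h y = real n} = (\<Union>B\<in>triang w. {y \<in> cell q B {}. h y = real n})" (is "?X = ?Y")
  proof
    show "?X \<subseteq> ?Y"
    proof
      fix y assume y: "y \<in> ?X"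
      then obtain B where "B \<in> triang w" "y \<in> halfopen_cone q B" using part[of y] by blast
      then show "y \<in> ?Y" using y by (auto simp: cell_def)
    qed
    show "?Y \<subseteq> ?X" using cell_subset triang_basis by fastforce
  qed
  have "card ?X = (\<Sum>B\<in>triang w. card {y \<in> cell q B {}. h y = real n})"
    unfolding eq
  proof (rule card_UN_disjoint)
    show "finite (triang w)" by (rule finite_triang)
    show "\<forall>B\<in>triang w. finite {y \<in> cell q B {}. h y = real n}"
      using finite_cell_degree triang_basis by blast
    show "\<forall>B\<in>triang w. \<forall>C\<in>triang w. B \<noteq> C \<longrightarrow>
        {y \<in> cell q B {}. h y = real n} \<inter> {y \<in> cell q C {}. h y = real n} = {}"
    proof (intro ballI impI)
      fix B C assume BC: "B \<in> triang w" "C \<in> triang w" "B \<noteq> C"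
      have False if "y \<in> cell q B {}" "y \<in> cell q C {}" for y
        using part[of y] that BC cell_subset[OF triang_basis[OF BC(1)], of q "{}"] by (auto simp: cell_def)
      then show "{y \<in> cell q B {}. h y = real n} \<inter> {y \<in> cell q C {}. h y = real n} = {}" by blast
    qed
  qed
  then show "fps_nth (Abs_fps ehrhart) n = fps_nth (\<Sum>B\<in>triang w. cell_series q B {}) n"
    by (simp add: ehrhart_def fps_sum_nth cell_series_def)
qed

text \<open>All cells have \<open>dim A\<close> vertices, so the single factor turns each cone
  series into the series of its box. Here \<open>S\<close> only selects the triangulation.\<close>

lemma ehrhart_numerator:
  fixes j :: nat
  assumes S: "basis S"
  shows ehrhart_numerator_eq_0: "dim A \<le> j \<Longrightarrow> fps_nth ((1 - fps_X) ^ dim A * Abs_fps ehrhart) j = 0"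
    and ehrhart_numerator_pos: "y \<in> L \<Longrightarrow> y \<in> span A \<Longrightarrow> (\<And>s. s \<in> S \<Longrightarrow> 0 \<le> coord S y s \<and> coord S y s < 1) \<Longrightarrow>
       h y = real j \<Longrightarrow> 0 < fps_nth ((1 - fps_X) ^ dim A * Abs_fps ehrhart) j"
proof -
  obtain w where w: "generic_weight w" "S \<in> triang w" using generic_weight_exists[OF S] by metis
  obtain q where q: "generic_point q" "\<And>s. s \<in> S \<Longrightarrow> 0 < coord S q s"
    using generic_point_exists[OF S] by metis
  have qs: "q \<in> span A" using q(1) by (simp add: generic_point_def)
  have qp: "q \<in> pos_span A"
    using pos_span_basis[OF S, of q] pos_span_basis_subset[OF S] qs q(2) by (auto simp: less_imp_le)
  have num: "fps_nth ((1 - fps_X) ^ dim A * Abs_fps ehrhart) j = (\<Sum>B\<in>triang w. int (card {y \<in> cell q B B. h y = real j}))" for j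
  proof -
    have "(1 - fps_X) ^ dim A * Abs_fps ehrhart = (\<Sum>B\<in>triang w. (1 - fps_X) ^ dim A * cell_series q B {})"
      unfolding ehrhart_decomposition[OF w(1) q(1) qp] by (simp add: sum_distrib_left)
    also have "\<dots> = (\<Sum>B\<in>triang w. cell_series q B B)"
    proof (rule sum.cong)
      fix B assume "B \<in> triang w"
      then have B: "basis B" by (rule triang_basis)
      show "(1 - fps_X) ^ dim A * cell_series q B {} = cell_series q B B"
        using cell_series_power[OF B, of B q] basis_card[OF B] by simp
    qed simp
    finally show ?thesis by (simp add: fps_sum_nth cell_series_def)
  qed
  show "fps_nth ((1 - fps_X) ^ dim A * Abs_fps ehrhart) j = 0" if j: "dim A \<le> j" for j
    unfolding num
  proof (rule sum.neutral, rule ballI)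
    fix B assume "B \<in> triang w"
    then have B: "basis B" by (rule triang_basis)
    have False if y: "y \<in> cell q B B" "h y = real j" for y
    proof -
      have ys: "y \<in> span A" using y by (simp add: cell_def halfopen_cone_def)
      have le: "coord B y b \<le> 1" if "b \<in> B" for b
        using y(1) that by (auto simp: cell_def split: if_splits)
      \<comment> \<open>The coordinate sum equals \<open>h q\<close> over every basis, so
        \<open>q\<close> has a positive coordinate over \<open>B\<close> too. There the box bound is
        strict, and the degree stays below \<open>dim A\<close>.\<close>
      have "0 < (\<Sum>b\<in>S. coord S q b)"
      proof (rule sum_pos)
        show "S \<noteq> {}"
          using S A_nonempty h_A linear_0[OF linear_h] by (force simp: basis_def)
      qed (use q(2) basis_finite[OF S] in auto)
      then have "0 < (\<Sum>b\<in>B. coord B q b)" using h_coord[OF S qs] h_coord[OF B qs] by simp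
      then obtain b where b: "b \<in> B" "0 < coord B q b" by (meson not_less sum_nonpos)
      have "coord B y b < 1" using y(1) b by (auto simp: cell_def)
      then have "(\<Sum>b\<in>B. coord B y b) < (\<Sum>b\<in>B. 1)"
        by (intro sum_strict_mono_ex1) (use le b basis_finite[OF B] in auto)
      then show False using h_coord[OF B ys] y(2) j basis_card[OF B] by simp
    qed
    then have "{y \<in> cell q B B. h y = real j} = {}" by blast
    then show "int (card {y \<in> cell q B B. h y = real j}) = 0" by (simp only: card.empty of_nat_0)
  qed
  show "0 < fps_nth ((1 - fps_X) ^ dim A * Abs_fps ehrhart) j" if y: "y \<in> L" "y \<in> span A"
    "\<And>s. s \<in> S \<Longrightarrow> 0 \<le> coord S y s \<and> coord S y s < 1" "h y = real j" for y j
  proof -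
    have "y \<in> {y \<in> cell q S S. h y = real j}"
      using y q(2) by (auto simp: cell_def halfopen_cone_def)
    then have "0 < card {y \<in> cell q S S. h y = real j}"
      using finite_cell_degree[OF S] by (auto simp: card_gt_0_iff)
    then show ?thesis unfolding num
      by (intro sum_pos2[OF finite_triang w(2)]) auto
  qed
qed

end

section \<open>Sums of points of bounded degree\<close>

lemma sum_list_replicate_scaleR: "sum_list (replicate n (b::'a::real_vector)) = real n *\<^sub>R b"
  by (induction n) (auto simp: scaleR_add_left)

lemma sum_scaleR_nat_eq_sum_list:
  fixes n :: "'a::real_vector \<Rightarrow> nat"
  assumes "finite B"
  obtains xs where "set xs \<subseteq> B" "(\<Sum>b\<in>B. real (n b) *\<^sub>R b) = sum_list xs"
proof -
  have "\<exists>xs. set xs \<subseteq> B \<and> (\<Sum>b\<in>B. real (n b) *\<^sub>R b) = sum_list xs"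
    using assms
  proof (induction B rule: finite_induct)
    case (insert b B)
    then obtain xs where "set xs \<subseteq> B" "(\<Sum>b\<in>B. real (n b) *\<^sub>R b) = sum_list xs" by blast
    then show ?case using insert.hyps
      by (intro exI[of _ "replicate (n b) b @ xs"]) (auto simp: sum_list_replicate_scaleR)
  qed simp
  then show ?thesis using that by blast
qed

context graded_lattice_cone
begin

definition M :: "'e set" where "M = pos_span A \<inter> L"

definition pbox :: "'e set \<Rightarrow> 'e set" where
  "pbox B = {y \<in> L \<inter> span A. \<forall>b\<in>B. 0 \<le> coord B y b \<and> coord B y b < 1}"

text \<open>The atoms of the monoid \<open>M\<close>, which turn out to be the Hilbert
  basis.\<close>

definition irreducibles :: "'e set" where
  "irreducibles = {y \<in> M - {0}. \<forall>u\<in>M - {0}. \<forall>v\<in>M - {0}. y \<noteq> u + v}"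

lemma M_add: "x \<in> M \<Longrightarrow> y \<in> M \<Longrightarrow> x + y \<in> M"
  by (simp add: M_def L_add pos_span_add)

lemma M_0: "0 \<in> M"
  by (simp add: M_def L_0 pos_span_0)

lemma A_M: "A \<subseteq> M"
  using A_L finite_A by (auto simp: M_def intro: pos_span_base)

lemma h_0: "h 0 = 0"
  using linear_0[OF linear_h] .

lemma M_sum_list: "set xs \<subseteq> M \<Longrightarrow> sum_list xs \<in> M"
  by (induction xs) (auto simp: M_0 M_add)

lemma h_sum_list: "h (sum_list xs) = sum_list (map h xs)"
  by (induction xs) (auto simp: h_0 h_add)

lemma h_sum_list_A: "set xs \<subseteq> A \<Longrightarrow> h (sum_list xs) = real (length xs)"
  by (induction xs) (auto simp: h_0 h_add h_A)

lemma M_degree: assumes "y \<in> M" obtains n where "h y = real n"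
proof -
  have "h y \<in> \<int>" "0 \<le> h y" using assms h_int h_nonneg by (auto simp: M_def)
  then have "h y = real (nat \<lfloor>h y\<rfloor>)" by simp
  then show ?thesis using that by blast
qed

text \<open>The degree is the sum of the coefficients, so degree 0 makes them all vanish;
  integrality does the rest.\<close>

lemma degree_ge_1: assumes "y \<in> M" "y \<noteq> 0" shows "1 \<le> h y"
proof -
  obtain c where c: "\<forall>a\<in>A. 0 \<le> c a" "y = (\<Sum>a\<in>A. c a *\<^sub>R a)"
    using assms(1) unfolding M_def pos_span_def by blast
  have "h y = (\<Sum>a\<in>A. c a)" unfolding c(2)
    by (simp add: linear_sum[OF linear_h] linear_cmul[OF linear_h] h_A)
  moreover have "(\<Sum>a\<in>A. c a) \<noteq> 0"
  proof
    assume "(\<Sum>a\<in>A. c a) = 0"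
    then have "\<forall>a\<in>A. c a = 0" using c(1) finite_A by (simp add: sum_nonneg_eq_0_iff)
    then show False using c(2) assms(2) by simp
  qed
  ultimately have "h y \<noteq> 0" by simp
  then show ?thesis using M_degree[OF assms(1)] by (metis One_nat_def Suc_leI gr0I of_nat_0 of_nat_1 of_nat_le_iff)
qed

lemma finite_degree_le: "finite {y \<in> M. h y \<le> real n}"
proof -
  have "{y \<in> M. h y \<le> real n} \<subseteq> (\<Union>k\<in>{..n}. {y \<in> pos_span A \<inter> L. h y = real k})"
  proof
    fix y assume y: "y \<in> {y \<in> M. h y \<le> real n}"
    then obtain k where "h y = real k" using M_degree by blast
    then show "y \<in> (\<Union>k\<in>{..n}. {y \<in> pos_span A \<inter> L. h y = real k})" using y by (auto simp: M_def)
  qed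
  then show ?thesis by (rule finite_subset) (use finite_degree in auto)
qed

lemma box_M: assumes "basis B" shows "pbox B \<subseteq> M"
  using pos_span_basis[OF assms] pos_span_basis_subset[OF assms] by (auto simp: pbox_def M_def)

lemma box_degree_less: assumes B: "basis B" and y: "y \<in> pbox B" shows "h y < real (dim A)"
proof -
  have ys: "y \<in> span A" using y by (simp add: pbox_def)
  have "B \<noteq> {}" using B A_nonempty h_A h_0 by (force simp: basis_def)
  then have "(\<Sum>b\<in>B. coord B y b) < (\<Sum>b\<in>B. 1)"
    by (intro sum_strict_mono) (use y basis_finite[OF B] in \<open>auto simp: pbox_def\<close>)
  then show ?thesis using h_coord[OF B ys] basis_card[OF B] by simp
qed

text \<open>If \<open>y\<close> in the box had degree \<open>dim A - 1\<close>, then reflecting it at the sum of the vertices would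
  give a lattice point of degree 1 in the relative interior of the simplex.\<close>

lemma empty_box_degree:
  assumes B: "basis B" "A \<inter> pos_span B = B" and y: "y \<in> pbox B" and d: "2 \<le> dim A"
  shows "h y \<le> real (dim A) - 2"
proof (rule ccontr)
  assume gt: "\<not> h y \<le> real (dim A) - 2"
  have ys: "y \<in> span A" and yL: "y \<in> L" using y by (auto simp: pbox_def)
  obtain n where n: "h y = real n" using M_degree box_M[OF B(1)] y by blast
  have "n < dim A" "\<not> n + 2 \<le> dim A" using n gt box_degree_less[OF B(1) y] by linarith+
  then have "dim A = n + 1" by simp
  then have hy: "h y = real (dim A) - 1" using n by simp
  have fB: "finite B" using basis_finite[OF B(1)] .
  have BL: "\<Sum>B \<in> L" "\<Sum>B \<in> span A"
  proof -
    have "\<Sum>C \<in> L" if "C \<subseteq> B" for C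
      using finite_subset[OF that fB] that
      by (induction C rule: finite_induct) (use L_0 L_add A_L B(1) in \<open>auto simp: basis_def\<close>)
    then show "\<Sum>B \<in> L" by simp
    show "\<Sum>B \<in> span A" by (rule span_sum) (use B(1) in \<open>auto simp: basis_def intro: span_base\<close>)
  qed
  define z where "z = \<Sum>B - y"
  have zs: "z \<in> span A" "z \<in> L" using BL ys yL L_diff by (auto simp: z_def intro: span_diff)
  have cB: "coord B (\<Sum>B) b = 1" if "b \<in> B" for b
    by (rule coord_unique[OF B(1) _ that, of _ "\<lambda>_. 1"]) simp
  have cz: "coord B z b > 0" if "b \<in> B" for b
    unfolding z_def using coord_diff[OF B(1) BL(2) ys, of b] cB[OF that] y that by (simp add: pbox_def)
  have zp: "z \<in> pos_span B" using pos_span_basis[OF B(1)] zs(1) cz by (auto simp: less_imp_le)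
  have "h (\<Sum>B) = real (dim A)" using h_coord[OF B(1) BL(2)] cB basis_card[OF B(1)] by simp
  then have "h z = 1" using hy by (simp add: z_def linear_diff[OF linear_h])
  then have "z \<in> B" using degree_1[of z] zp zs(2) pos_span_basis_subset[OF B(1)] B(2) by blast
  \<comment> \<open>Being a vertex, \<open>z\<close> has coordinate 0 at any other vertex, although
    all its coordinates are positive.\<close>
  moreover obtain b where "b \<in> B" "b \<noteq> z"
  proof -
    have "\<not> B \<subseteq> {z}" using d basis_card[OF B(1)] card_mono[of "{z}" B] by auto
    then show ?thesis using that by blast
  qed
  ultimately show False using cz[of b] coord_base[OF B(1), of z b] by simp
qed

text \<open>Split the coordinates over an empty simplex into fractional parts, giving
  \<open>y\<close>, and integer parts, giving \<open>xs\<close>.\<close>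

lemma box_decomposition:
  assumes z: "z \<in> M"
  obtains B y xs where "basis B" "A \<inter> pos_span B = B" "y \<in> pbox B" "set xs \<subseteq> A" "z = y + sum_list xs"
proof -
  obtain B where B: "basis B" "z \<in> pos_span B" "A \<inter> pos_span B = B"
    using empty_basis_exists z by (auto simp: M_def)
  have zs: "z \<in> span A" "\<And>b. b \<in> B \<Longrightarrow> 0 \<le> coord B z b" using B(2) pos_span_basis[OF B(1)] by auto
  have fB: "finite B" using basis_finite[OF B(1)] .
  define n where "n b = nat \<lfloor>coord B z b\<rfloor>" for b
  obtain xs where xs: "set xs \<subseteq> B" "(\<Sum>b\<in>B. real (n b) *\<^sub>R b) = sum_list xs"
    using sum_scaleR_nat_eq_sum_list[OF fB] by metis
  have xsA: "set xs \<subseteq> A" using xs(1) B(1) by (auto simp: basis_def)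
  have sM: "sum_list xs \<in> M" using M_sum_list xsA A_M by blast
  define y where "y = z - sum_list xs"
  have ss: "sum_list xs \<in> span A" using sM pos_span_subset_span by (auto simp: M_def)
  have "coord B (sum_list xs) b = real (n b)" if "b \<in> B" for b
    by (rule coord_unique[OF B(1) _ that]) (simp add: xs(2))
  then have "coord B y b = coord B z b - real (n b)" if "b \<in> B" for b
    unfolding y_def using coord_diff[OF B(1) zs(1) ss] that by simp
  moreover have "0 \<le> coord B z b - real (n b) \<and> coord B z b - real (n b) < 1" if "b \<in> B" for b
    unfolding n_def using zs(2)[OF that] by (simp add: of_nat_nat) linarith
  ultimately have "y \<in> pbox B"
    unfolding pbox_def using z sM L_diff zs(1) ss by (auto simp: y_def M_def intro: span_diff)
  then show ?thesis by (rule that[OF B(1,3) _ xsA]) (simp add: y_def)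
qed

text \<open>Bin packing: each bin of capacity \<open>n\<close> receives at most one large item from
  \<open>ys\<close> and is filled up with items of degree 1. The total degree \<open>k * n\<close>
  makes the supply exact.\<close>

lemma group_into_degree:
  assumes "set ys \<subseteq> M" "\<And>y. y \<in> set ys \<Longrightarrow> h y \<le> real n" "set xs \<subseteq> A" "length ys \<le> k"
    and "h (sum_list ys) + real (length xs) = real (k * n)"
  shows "\<exists>f. (\<forall>i<k. f i \<in> M \<and> h (f i) = real n) \<and> sum_list ys + sum_list xs = (\<Sum>i<k. f i)"
  using assms
proof (induction k arbitrary: ys xs)
  case 0
  then show ?case by (simp add: h_0)
next
  case (Suc k)
  obtain y zs where yz: "y \<in> M" "h y \<le> real n" "set zs \<subseteq> M" "\<And>y. y \<in> set zs \<Longrightarrow> h y \<le> real n"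
    "length zs \<le> k" "sum_list ys = y + sum_list zs"
  proof (cases ys)
    case Nil
    \<comment> \<open>Without a large item, 0 takes its place and the bin holds points of degree 1
      only.\<close>
    then show ?thesis using that[of 0 "[]"] by (simp add: M_0 h_0)
  next
    case (Cons y zs)
    then show ?thesis using that[of y zs] Suc.prems by auto
  qed
  obtain m where m: "h y = real m" using M_degree[OF yz(1)] by blast
  define l where "l = n - m"
  have mn: "m \<le> n" using yz(2) m by simp
  have "h (sum_list zs) \<le> real (length zs) * real n"
    using sum_list_mono[of zs h "\<lambda>_. real n"] yz(4) by (simp add: h_sum_list sum_list_triv)
  also have "\<dots> \<le> real k * real n" using yz(5) by (simp add: mult_right_mono)
  finally have hz: "h (sum_list zs) \<le> real k * real n" .
  have tot: "real m + h (sum_list zs) + real (length xs) = real k * real n + real n"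
    using Suc.prems(5) yz(6) m by (simp add: h_add algebra_simps)
  \<comment> \<open>The remaining large items have total degree at most \<open>k * n\<close>, so
    enough points of degree 1 are left for this bin.\<close>
  have lx: "l \<le> length xs" using hz tot mn unfolding l_def by linarith
  have dx: "h (sum_list zs) + real (length (drop l xs)) = real (k * n)"
    using tot mn lx unfolding l_def by (simp add: of_nat_diff)
  obtain f where f: "\<forall>i<k. f i \<in> M \<and> h (f i) = real n"
    "sum_list zs + sum_list (drop l xs) = (\<Sum>i<k. f i)"
    using Suc.IH[OF yz(3,4) _ yz(5) dx] Suc.prems(3) set_drop_subset[of l xs] by blast
  have tA: "set (take l xs) \<subseteq> A" using Suc.prems(3) set_take_subset[of l xs] by blast
  have "h (y + sum_list (take l xs)) = real n"
    using h_sum_list_A[OF tA] m lx mn by (simp add: h_add l_def of_nat_diff)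
  moreover have "y + sum_list (take l xs) \<in> M"
    using M_add[OF yz(1)] M_sum_list[of "take l xs"] tA A_M by blast
  moreover have "sum_list xs = sum_list (take l xs) + sum_list (drop l xs)"
    by (metis append_take_drop_id sum_list_append)
  then have "sum_list ys + sum_list xs = (y + sum_list (take l xs)) + (\<Sum>i<k. f i)"
    using yz(6) f(2)[symmetric] by (simp add: algebra_simps)
  ultimately show ?case using f(1)
    by (intro exI[of _ "\<lambda>i. if i < k then f i else y + sum_list (take l xs)"]) (auto simp: less_Suc_eq)
qed

text \<open>Induction on the degree: both parts of a splitting have degree at least 1, hence smaller
  degree than \<open>z\<close>.\<close>

lemma irreducible_decomposition:
  assumes "z \<in> M"
  obtains ys where "set ys \<subseteq> irreducibles" "z = sum_list ys"
proof -
  have "\<exists>ys. set ys \<subseteq> irreducibles \<and> z = sum_list ys" if "z \<in> M" "h z = real n" for n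
    using that
  proof (induction n arbitrary: z rule: less_induct)
    case (less n)
    consider "z = 0" | "z \<in> irreducibles" | u v where "u \<in> M - {0}" "v \<in> M - {0}" "z = u + v"
      using less.prems by (auto simp: irreducibles_def)
    then show ?case
    proof cases
      case 1 then show ?thesis by (intro exI[of _ "[]"]) auto
    next
      case 2 then show ?thesis by (intro exI[of _ "[z]"]) auto
    next
      case 3
      obtain i j where ij: "h u = real i" "h v = real j" using 3 M_degree by (metis DiffD1)
      have "real i \<ge> 1" "real j \<ge> 1" "real n = real i + real j"
        using degree_ge_1 3 ij less.prems h_add by force+
      then have "i < n" "j < n" by linarith+
      then obtain us vs where "set us \<subseteq> irreducibles" "u = sum_list us" "set vs \<subseteq> irreducibles" "v = sum_list vs"
        using less.IH 3 ij by (metis DiffD1)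
      then show ?thesis using 3 by (intro exI[of _ "us @ vs"]) auto
    qed
  qed
  moreover obtain n where "h z = real n" using M_degree[OF assms] by blast
  ultimately obtain ys where "set ys \<subseteq> irreducibles" "z = sum_list ys" using assms by metis
  then show ?thesis by (rule that)
qed

text \<open>In a sum that cannot be split, all entries but one are forced to contribute 0.\<close>

lemma irreducible_in_list:
  assumes "set ys \<subseteq> M" "sum_list ys \<in> irreducibles" shows "sum_list ys \<in> set ys"
  using assms
proof (induction ys)
  case (Cons y ys)
  then have "y \<in> M" "sum_list ys \<in> M" using M_sum_list by auto
  then have "y = 0 \<or> sum_list ys = 0" using Cons.prems(2) by (auto simp: irreducibles_def)
  then show ?case using Cons by auto
qed (simp add: irreducibles_def)

lemma irreducibles_nonempty: "irreducibles \<noteq> {}"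
proof
  assume e: "irreducibles = {}"
  obtain a where a: "a \<in> A" using A_nonempty by blast
  then obtain ys where "set ys \<subseteq> irreducibles" "a = sum_list ys"
    using irreducible_decomposition A_M by blast
  then have "a = 0" using e by simp
  then show False using h_A[OF a] h_0 by simp
qed

text \<open>A box element has degree below \<open>dim A\<close> and each atom has degree at least 1,
  so its atoms fit into \<open>k\<close> bins. The threshold on \<open>k\<close> does not depend on
  \<open>z\<close>.\<close>

lemma decomposition_irreducible_bound:
  assumes m: "\<And>y. y \<in> irreducibles \<Longrightarrow> h y \<le> real m" and k: "dim A \<le> k"
    and z: "z \<in> M" "h z = real (k * m)"
  shows "\<exists>f. (\<forall>i<k. f i \<in> M \<and> h (f i) = real m) \<and> z = (\<Sum>i<k. f i)"
proof -
  obtain B y xs where B: "basis B" "y \<in> pbox B" "set xs \<subseteq> A" "z = y + sum_list xs"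
    using box_decomposition[OF z(1)] by metis
  have yM: "y \<in> M" using box_M B by blast
  obtain ys where ys: "set ys \<subseteq> irreducibles" "y = sum_list ys"
    using irreducible_decomposition[OF yM] by metis
  have iM: "irreducibles \<subseteq> M - {0}" by (auto simp: irreducibles_def)
  have "real (length ys) \<le> h y"
    using sum_list_mono[of ys "\<lambda>_. 1" h] degree_ge_1 ys iM by (auto simp: h_sum_list sum_list_triv)
  then have "length ys \<le> k" using box_degree_less[OF B(1,2)] k by linarith
  moreover have "h (sum_list ys) + real (length xs) = real (k * m)"
    using z(2) B(3,4) ys(2) h_sum_list_A by (simp add: h_add)
  ultimately show ?thesis
    using group_into_degree[of ys m xs k] ys iM m B(3,4) by blast
qed

text \<open>\<open>H\<close> stands for \<open>mu_hole\<close>. Box elements that are already sums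
  of points of \<open>A\<close> are exempt from the bound, and \<open>1 \<le> H\<close> matches the
  value 1 in the absence of holes.\<close>

context
  fixes H :: nat
  assumes H_pos: "1 \<le> H"
    and H_bound: "\<And>B y. basis B \<Longrightarrow> A \<inter> pos_span B = B \<Longrightarrow> y \<in> pbox B \<Longrightarrow>
      (\<nexists>xs. set xs \<subseteq> A \<and> y = sum_list xs) \<Longrightarrow> h y \<le> real H"
begin

text \<open>A list of length at most 1 encodes an optional hole, ready for
  \<open>group_into_degree\<close>.\<close>

lemma hole_decomposition:
  assumes "z \<in> M"
  obtains ys xs where "set ys \<subseteq> M" "length ys \<le> 1" "\<And>y. y \<in> set ys \<Longrightarrow> h y \<le> real H"
    "set xs \<subseteq> A" "z = sum_list ys + sum_list xs"
proof -
  obtain B y xs where B: "basis B" "A \<inter> pos_span B = B" "y \<in> pbox B" "set xs \<subseteq> A" "z = y + sum_list xs"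
    using box_decomposition[OF assms] by metis
  show ?thesis
  proof (cases "\<exists>xs. set xs \<subseteq> A \<and> y = sum_list xs")
    case True
    then obtain us where "set us \<subseteq> A" "y = sum_list us" by blast
    then show ?thesis using that[of "[]" "us @ xs"] B by auto
  next
    case False
    then show ?thesis using that[of "[y]" xs] B H_bound[OF B(1-3)] subsetD[OF box_M[OF B(1)] B(3)] by auto
  qed
qed

text \<open>At most one large item occurs, so a single bin suffices and every
  \<open>k \<ge> 1\<close> works.\<close>

lemma decomposition_hole_bound:
  assumes n: "H \<le> n" and k: "1 \<le> k" and z: "z \<in> M" "h z = real (k * n)"
  shows "\<exists>f. (\<forall>i<k. f i \<in> M \<and> h (f i) = real n) \<and> z = (\<Sum>i<k. f i)"
proof -
  obtain ys xs where d: "set ys \<subseteq> M" "length ys \<le> 1" "\<And>y. y \<in> set ys \<Longrightarrow> h y \<le> real H"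
    "set xs \<subseteq> A" "z = sum_list ys + sum_list xs"
    using hole_decomposition[OF z(1)] by metis
  have "h (sum_list ys) + real (length xs) = real (k * n)"
    using z(2) d(4,5) h_sum_list_A by (simp add: h_add)
  then show ?thesis
    using group_into_degree[of ys n xs k] d n k by force
qed

text \<open>An atom equals one of its summands, so it is the hole itself or a point of degree
  1.\<close>

lemma irreducible_degree_le: assumes z: "z \<in> irreducibles" shows "h z \<le> real H"
proof -
  have zM: "z \<in> M" "z \<noteq> 0" using z by (auto simp: irreducibles_def)
  obtain ys xs where d: "set ys \<subseteq> M" "length ys \<le> 1" "\<And>y. y \<in> set ys \<Longrightarrow> h y \<le> real H"
    "set xs \<subseteq> A" "z = sum_list ys + sum_list xs"
    using hole_decomposition[OF zM(1)] by metis
  then have "z \<in> set (ys @ xs)"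
    using irreducible_in_list[of "ys @ xs"] z A_M by auto
  then show ?thesis using d(3,4) h_A H_pos by auto
qed

lemma finite_irreducibles: "finite irreducibles"
  by (rule finite_subset[OF _ finite_degree_le[of H]])
     (use irreducible_degree_le in \<open>auto simp: irreducibles_def\<close>)

end

end

section \<open>Lattice polytopes\<close>

lemma lattice_add: "x \<in> lattice \<Longrightarrow> y \<in> lattice \<Longrightarrow> x + y \<in> lattice"
  by (simp add: lattice_def)

lemma lattice_diff: "x \<in> lattice \<Longrightarrow> y \<in> lattice \<Longrightarrow> x - y \<in> lattice"
  by (simp add: lattice_def)

lemma lattice_0: "0 \<in> lattice"
  by (simp add: lattice_def)

lemma finite_bounded_lattice:
  fixes S :: "(real^'n) set"
  assumes "bounded S" shows "finite (S \<inter> lattice)"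
proof -
  obtain m where m: "\<And>x. x \<in> S \<Longrightarrow> norm x \<le> m" using assms by (auto simp: bounded_iff)
  define F where "F = {k::real. k \<in> \<int> \<and> \<bar>k\<bar> \<le> m}"
  have "finite F" unfolding F_def by (rule finite_abs_int_segment)
  then have "finite (UNIV \<rightarrow>\<^sub>E F :: ('n \<Rightarrow> real) set)" by (intro finite_PiE) auto
  moreover have "S \<inter> lattice \<subseteq> vec_lambda ` (UNIV \<rightarrow>\<^sub>E F)"
  proof
    fix x assume x: "x \<in> S \<inter> lattice"
    have "x $ i \<in> F" for i
      unfolding F_def using x m[of x] component_le_norm_cart[of x i] by (auto simp: lattice_def)
    then show "x \<in> vec_lambda ` (UNIV \<rightarrow>\<^sub>E F)"
      by (intro image_eqI[of _ _ "vec_nth x"]) auto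
  qed
  ultimately show ?thesis by (meson finite_imageI finite_subset)
qed

text \<open>Repetition in a list replaces multiplicities, recovered by \<open>count_list\<close>;
  lists suit induction and concatenation.\<close>

lemma nonneg_int_comb_eq: "nonneg_int_comb X = {y. \<exists>xs. set xs \<subseteq> X \<and> y = sum_list xs}"
proof
  show "nonneg_int_comb X \<subseteq> {y. \<exists>xs. set xs \<subseteq> X \<and> y = sum_list xs}"
  proof
    fix y assume "y \<in> nonneg_int_comb X"
    then obtain U c where U: "finite U" "U \<subseteq> X" "y = (\<Sum>u\<in>U. real (c u) *\<^sub>R u)"
      unfolding nonneg_int_comb_def by blast
    then obtain xs where "set xs \<subseteq> U" "y = sum_list xs"
      using sum_scaleR_nat_eq_sum_list[OF U(1)] by metis
    then show "y \<in> {y. \<exists>xs. set xs \<subseteq> X \<and> y = sum_list xs}" using U(2) by blast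
  qed
  show "{y. \<exists>xs. set xs \<subseteq> X \<and> y = sum_list xs} \<subseteq> nonneg_int_comb X"
  proof
    fix y assume "y \<in> {y. \<exists>xs. set xs \<subseteq> X \<and> y = sum_list xs}"
    then obtain xs where xs: "set xs \<subseteq> X" "y = sum_list xs" by blast
    have "sum_list zs = (\<Sum>u\<in>set xs. real (count_list zs u) *\<^sub>R u)" if "set zs \<subseteq> set xs" for zs
      using that
    proof (induction zs)
      case (Cons z zs)
      have "(\<Sum>u\<in>set xs. real (count_list (z # zs) u) *\<^sub>R u) =
          (\<Sum>u\<in>set xs. real (count_list zs u) *\<^sub>R u + (if u = z then u else 0))"
        by (rule sum.cong) (auto simp: scaleR_add_left)
      then show ?case using Cons by (simp add: sum.distrib add.commute)
    qed simp
    then have "y = (\<Sum>u\<in>set xs. real (count_list xs u) *\<^sub>R u)" using xs(2) by simp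
    then show "y \<in> nonneg_int_comb X" unfolding nonneg_int_comb_def using xs(1) by blast
  qed
qed

lemma lattice1_iff: "(x, t) \<in> lattice1 \<longleftrightarrow> x \<in> lattice \<and> t \<in> \<int>"
  by (simp add: lattice1_def)

lemma lift_iff: "(x, t) \<in> lift W \<longleftrightarrow> x \<in> W \<and> t = 1"
  by (auto simp: lift_def)

lemma sum_scaleR_pair: "(\<Sum>w\<in>W. c w *\<^sub>R (w, 1::real)) = (\<Sum>w\<in>W. c w *\<^sub>R w, \<Sum>w\<in>W. c w)"
  by (induction W rule: infinite_finite_induct) (auto simp: zero_prod_def)

lemma sum_lift: "(\<Sum>a\<in>lift W. c a *\<^sub>R a) = (\<Sum>w\<in>W. c (w, 1) *\<^sub>R w, \<Sum>w\<in>W. c (w, 1))"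
  unfolding lift_def sum_scaleR_pair[of "\<lambda>w. c (w, 1)", symmetric]
  by (subst sum.reindex) (auto simp: inj_on_def)

text \<open>The last coordinate of a conic combination is its coefficient sum.\<close>

lemma pos_span_lift_degree_1:
  assumes "finite W"
  shows "(x, 1) \<in> pos_span (lift W) \<longleftrightarrow> x \<in> convex hull W"
proof
  assume "(x, 1) \<in> pos_span (lift W)"
  then obtain c where c: "\<forall>a\<in>lift W. 0 \<le> c a" "(x, 1) = (\<Sum>a\<in>lift W. c a *\<^sub>R a)"
    unfolding pos_span_def by blast
  then have "(\<Sum>w\<in>W. c (w, 1)) = 1" "(\<Sum>w\<in>W. c (w, 1) *\<^sub>R w) = x"
    by (auto simp: sum_lift)
  then show "x \<in> convex hull W" unfolding convex_hull_finite[OF assms]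
    using c(1) by (intro CollectI exI[of _ "\<lambda>w. c (w, 1)"]) (auto simp: lift_def)
next
  assume "x \<in> convex hull W"
  then obtain u where "\<forall>w\<in>W. 0 \<le> u w" "sum u W = 1" "(\<Sum>w\<in>W. u w *\<^sub>R w) = x"
    unfolding convex_hull_finite[OF assms] by blast
  then show "(x, 1) \<in> pos_span (lift W)"
    by (intro pos_spanI[of _ "\<lambda>a. u (fst a)"]) (simp_all add: sum_lift, auto simp: lift_def)
qed

text \<open>The last coordinate of a linear relation among lifted points is the zero-sum condition
  of an affine relation.\<close>

lemma independent_lift_iff:
  fixes W :: "(real^'n) set"
  assumes "finite W" shows "independent (lift W) \<longleftrightarrow> \<not> affine_dependent W"
proof -
  have fl: "finite (lift W)" using assms by (simp add: lift_def)
  have "dependent (lift W) \<longleftrightarrow> affine_dependent W"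
  proof
    assume "dependent (lift W)"
    then obtain u where "\<exists>v\<in>lift W. u v \<noteq> 0" "(\<Sum>v\<in>lift W. u v *\<^sub>R v) = 0"
      unfolding dependent_finite[OF fl] by blast
    then have "(\<Sum>w\<in>W. u (w, 1)) = 0" "(\<Sum>w\<in>W. u (w, 1) *\<^sub>R w) = 0" "\<exists>w\<in>W. u (w, 1) \<noteq> 0"
      by (simp_all add: sum_lift zero_prod_def) (auto simp: lift_def)
    then show "affine_dependent W" unfolding affine_dependent_explicit_finite[OF assms]
      by (intro exI[of _ "\<lambda>w. u (w, 1)"]) auto
  next
    assume "affine_dependent W"
    then obtain u where "sum u W = 0" "\<exists>v\<in>W. u v \<noteq> 0" "(\<Sum>v\<in>W. u v *\<^sub>R v) = 0"
      unfolding affine_dependent_explicit_finite[OF assms] by blast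
    then show "dependent (lift W)" unfolding dependent_finite[OF fl]
      by (intro exI[of _ "\<lambda>a. u (fst a)"]) (simp add: sum_lift zero_prod_def, auto simp: lift_def)
  qed
  then show ?thesis by blast
qed

lemma sum_scaleR_in_dilate:
  fixes P :: "(real^'n) set"
  assumes P: "convex P" "P \<noteq> {}" and W: "finite W" "W \<subseteq> P" "\<And>w. w \<in> W \<Longrightarrow> 0 \<le> c w"
  shows "(\<Sum>w\<in>W. c w *\<^sub>R w) \<in> dilate (sum c W) P"
proof (cases "sum c W = 0")
  \<comment> \<open>Normalisation would divide by 0 here; instead, \<open>dilate 0 P\<close>
    contains 0 because \<open>P\<close> is nonempty.\<close>
  case True
  then have "\<forall>w\<in>W. c w = 0" using W by (simp add: sum_nonneg_eq_0_iff)
  then show ?thesis using True P(2) by (auto simp: dilate_def)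
next
  case False
  have pos: "0 \<le> sum c W" using W(3) by (simp add: sum_nonneg)
  have "(\<Sum>w\<in>W. (c w / sum c W) *\<^sub>R w) \<in> P"
    by (rule convex_sum[OF W(1) P(1)]) (use False pos W in \<open>auto simp: sum_divide_distrib[symmetric]\<close>)
  moreover have "(\<Sum>w\<in>W. c w *\<^sub>R w) = sum c W *\<^sub>R (\<Sum>w\<in>W. (c w / sum c W) *\<^sub>R w)"
    using False by (simp add: scaleR_sum_right)
  ultimately show ?thesis unfolding dilate_def by blast
qed

text \<open>Dividing a conic combination of vertices by its height gives a convex one. This
  translates statements about dilates into statements about one graded cone.\<close>

lemma cone_of_eq_dilates:
  fixes P :: "(real^'n) set"
  assumes "polytope P" "P \<noteq> {}"
  shows "cone_of P = {(x, t). 0 \<le> t \<and> x \<in> dilate t P}" (is "_ = ?D")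
proof
  have conv: "convex P" using assms(1) polytope_imp_convex by blast
  define V where "V = {v. v extreme_point_of P}"
  have PV: "P = convex hull V" unfolding V_def
    using Krein_Milman_Minkowski[of P] assms(1) polytope_imp_compact conv by blast
  have VP: "V \<subseteq> P" by (auto simp: V_def extreme_point_of_def)
  have fV: "finite V" unfolding V_def
    using finite_polyhedron_extreme_points[of P] polytope_imp_polyhedron assms(1) by blast
  show "cone_of P \<subseteq> ?D"
  proof
    fix y assume "y \<in> cone_of P"
    then obtain U c where U: "finite U" "U \<subseteq> lift V" "\<forall>u\<in>U. 0 \<le> c u" "y = (\<Sum>u\<in>U. c u *\<^sub>R u)"
      unfolding cone_of_def V_def by blast
    define W where "W = fst ` U"
    have UW: "U = lift W" using U(2) unfolding W_def lift_def by force
    have WP: "W \<subseteq> P" "finite W" using U(1,2) VP unfolding W_def lift_def by auto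
    define t where "t = (\<Sum>w\<in>W. c (w, 1))"
    have y: "y = (\<Sum>w\<in>W. c (w, 1) *\<^sub>R w, t)" unfolding U(4) UW sum_lift t_def ..
    have c0: "\<And>w. w \<in> W \<Longrightarrow> 0 \<le> c (w, 1)" using U(3) UW by (auto simp: lift_def)
    then have t0: "0 \<le> t" unfolding t_def by (simp add: sum_nonneg)
    have "(\<Sum>w\<in>W. c (w, 1) *\<^sub>R w) \<in> dilate t P"
      unfolding t_def by (rule sum_scaleR_in_dilate) (use c0 WP conv assms(2) in auto)
    then show "y \<in> ?D" using y t0 by simp
  qed
  show "?D \<subseteq> cone_of P"
  proof
    fix y assume "y \<in> ?D"
    then obtain p t where p: "p \<in> P" "0 \<le> t" "y = (t *\<^sub>R p, t)" unfolding dilate_def by auto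
    obtain u where u: "\<forall>v\<in>V. 0 \<le> u v" "sum u V = 1" "(\<Sum>v\<in>V. u v *\<^sub>R v) = p"
      using p(1) unfolding PV convex_hull_finite[OF fV] by blast
    have "y = (\<Sum>a\<in>lift V. (t * u (fst a)) *\<^sub>R a)"
      unfolding sum_lift p(3) using u
      by (simp add: sum_distrib_left[symmetric] scaleR_sum_right[symmetric] scaleR_scaleR[symmetric] del: scaleR_scaleR)
    then show "y \<in> cone_of P" unfolding cone_of_def V_def[symmetric]
      using fV u(1) p(2) by (intro CollectI exI[of _ "lift V"] exI[of _ "\<lambda>a. t * u (fst a)"]) (auto simp: lift_def)
  qed
qed

lemma dilate_dilate: "dilate s (dilate t P) = dilate (s * t) P"
  by (auto simp: dilate_def image_image)

lemma bounded_dilate: "bounded P \<Longrightarrow> bounded (dilate t P)"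
  unfolding dilate_def by (rule bounded_scaling)

section \<open>The homogenised polytope as a graded lattice cone\<close>

locale int_polytope =
  fixes P :: "(real^'n) set" and d :: nat
  assumes integral: "integral_polytope P" and aff_dim_P: "aff_dim P = int d"
begin

definition pts :: "((real^'n) \<times> real) set" where
  "pts = lift P \<inter> lattice1"

lemma polytope_P: "polytope P"
  using integral by (simp add: integral_polytope_def)

lemma P_nonempty: "P \<noteq> {}"
  using aff_dim_P by auto

lemma vertices_lattice: "{v. v extreme_point_of P} \<subseteq> P \<inter> lattice"
  using integral by (auto simp: integral_polytope_def extreme_point_of_def)

lemma P_eq_hull: "P = convex hull {v. v extreme_point_of P}"
  by (rule Krein_Milman_Minkowski) (simp_all add: polytope_P polytope_imp_compact polytope_imp_convex)

lemma pts_eq: "pts = lift (P \<inter> lattice)"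
  by (auto simp: pts_def lift_def lattice1_def)

lemma pts_iff: "(x, t) \<in> pts \<longleftrightarrow> x \<in> P \<and> x \<in> lattice \<and> t = 1"
  by (auto simp: pts_eq lift_iff)

lemma finite_pts: "finite pts"
  unfolding pts_eq lift_def
  by (intro finite_imageI finite_bounded_lattice polytope_imp_bounded polytope_P)

text \<open>\<open>cone_of\<close> is generated by vertices, the abstract theory by all lattice
  points of \<open>P\<close>. These lie in \<open>P\<close>, so they do not enlarge the
  cone.\<close>

lemma pos_span_pts: "pos_span pts = cone_of P"
proof
  show "cone_of P \<subseteq> pos_span pts"
  proof
    fix y assume "y \<in> cone_of P"
    then obtain U c where U: "finite U" "U \<subseteq> lift {v. v extreme_point_of P}" "\<forall>u\<in>U. 0 \<le> c u"
      "y = (\<Sum>u\<in>U. c u *\<^sub>R u)" unfolding cone_of_def by blast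
    have "U \<subseteq> pts" using U(2) vertices_lattice by (force simp: pts_iff lift_iff)
    then show "y \<in> pos_span pts"
      unfolding U(4) using U(3) by (intro pos_span_sum pos_span_scale pos_span_base finite_pts) auto
  qed
  show "pos_span pts \<subseteq> cone_of P"
  proof
    fix y assume "y \<in> pos_span pts"
    then obtain c where c: "\<forall>a\<in>lift (P \<inter> lattice). 0 \<le> c a" "y = (\<Sum>a\<in>lift (P \<inter> lattice). c a *\<^sub>R a)"
      unfolding pos_span_def pts_eq by blast
    define W where "W = P \<inter> lattice"
    define t where "t = (\<Sum>w\<in>W. c (w, 1))"
    have fW: "finite W" unfolding W_def
      by (intro finite_bounded_lattice polytope_imp_bounded polytope_P)
    have y: "y = (\<Sum>w\<in>W. c (w, 1) *\<^sub>R w, t)" unfolding c(2) sum_lift t_def W_def ..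
    have c0: "\<And>w. w \<in> W \<Longrightarrow> 0 \<le> c (w, 1)" using c(1) by (auto simp: lift_def W_def)
    then have t0: "0 \<le> t" unfolding t_def by (simp add: sum_nonneg)
    have "(\<Sum>w\<in>W. c (w, 1) *\<^sub>R w) \<in> dilate t P"
      unfolding t_def
      by (rule sum_scaleR_in_dilate) (use c0 fW polytope_P P_nonempty in \<open>auto simp: W_def polytope_imp_convex\<close>)
    then show "y \<in> cone_of P" using y t0 cone_of_eq_dilates[OF polytope_P P_nonempty] by simp
  qed
qed

lemma mem_pos_span_pts: "(x, t) \<in> pos_span pts \<longleftrightarrow> 0 \<le> t \<and> x \<in> dilate t P"
  unfolding pos_span_pts cone_of_eq_dilates[OF polytope_P P_nonempty] by simp

lemma degree_slice: "0 \<le> t \<Longrightarrow> t \<in> \<int> \<Longrightarrow>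
    {y \<in> pos_span pts \<inter> lattice1. snd y = t} = (\<lambda>x. (x, t)) ` (dilate t P \<inter> lattice)"
  by (auto simp: mem_pos_span_pts lattice1_iff)

text \<open>Finiteness in each degree is boundedness of a dilate, and \<open>degree_1\<close> holds
  because the slice at height 1 is \<open>P\<close> itself.\<close>

sublocale graded_lattice_cone pts snd lattice1
proof (intro graded_lattice_cone.intro graded_points.intro graded_lattice_cone_axioms.intro)
  show "finite pts" by (rule finite_pts)
  show "linear (snd :: (real^'n) \<times> real \<Rightarrow> real)" by (rule linear_snd)
  show "snd a = 1" if "a \<in> pts" for a using that by (cases a) (simp add: pts_iff)
  show "x + y \<in> lattice1" if "x \<in> lattice1" "y \<in> lattice1" for x y :: "(real^'n) \<times> real"
    using that by (auto simp: lattice1_def lattice_add)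
  show "x - y \<in> lattice1" if "x \<in> lattice1" "y \<in> lattice1" for x y :: "(real^'n) \<times> real"
    using that by (auto simp: lattice1_def lattice_diff)
  show "(0 :: (real^'n) \<times> real) \<in> lattice1" by (simp add: lattice1_def lattice_0 zero_prod_def)
  show "pts \<subseteq> lattice1" by (simp add: pts_def)
  show "pts \<noteq> {}"
  proof -
    have "{v. v extreme_point_of P} \<noteq> {}" using P_eq_hull P_nonempty by (metis convex_hull_empty)
    then show ?thesis using vertices_lattice by (auto simp: pts_eq lift_def)
  qed
  show "snd y \<in> \<int>" if "y \<in> lattice1" for y :: "(real^'n) \<times> real" using that by (auto simp: lattice1_def)
  show "finite {y \<in> pos_span pts \<inter> lattice1. snd y = t}" for t
  proof (cases "0 \<le> t \<and> t \<in> \<int>")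
    case True
    then have "{y \<in> pos_span pts \<inter> lattice1. snd y = t} = (\<lambda>x. (x, t)) ` (dilate t P \<inter> lattice)"
      using degree_slice by blast
    then show ?thesis
      using finite_bounded_lattice bounded_dilate polytope_imp_bounded polytope_P by (metis finite_imageI)
  next
    case False
    then have "{y \<in> pos_span pts \<inter> lattice1. snd y = t} = {}"
      by (auto simp: mem_pos_span_pts lattice1_iff)
    then show ?thesis by (metis finite.emptyI)
  qed
  show "y \<in> pts" if "y \<in> pos_span pts" "y \<in> lattice1" "snd y = 1" for y
    using that by (cases y) (auto simp: mem_pos_span_pts dilate_def pts_iff lattice1_iff)
qed

lemma M_eq: "M = cone_of P \<inter> lattice1"
  by (simp add: M_def pos_span_pts)

lemma deg_M: "y \<in> M \<Longrightarrow> real (deg y) = snd y"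
  by (erule M_degree) (simp add: deg_def)

text \<open>Inside \<open>P\<close>, a set of the same affine dimension has the same affine hull,
  and affine combinations lift to linear ones.\<close>

lemma basis_lift:
  assumes W: "W \<subseteq> P \<inter> lattice" "\<not> affine_dependent W" "card W = d + 1"
  shows "basis (lift W)"
proof -
  have fW: "finite W" using W(3) by (metis Suc_eq_plus1 card.infinite nat.distinct(1))
  have "aff_dim W = int d" using aff_dim_affine_independent[OF W(2)] W(3) by simp
  then have "affine hull W = affine hull P"
    using W(1) aff_dim_P aff_dim_eq_full_gen[of W P] by auto
  then have PW: "P \<subseteq> affine hull W" using hull_subset[of P affine] by simp
  have "pts \<subseteq> span (lift W)"
  proof
    fix y assume "y \<in> pts"
    then obtain x where x: "x \<in> P" "y = (x, 1)" by (cases y) (simp add: pts_iff)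
    obtain u where "sum u W = 1" "(\<Sum>v\<in>W. u v *\<^sub>R v) = x"
      using PW x(1) unfolding affine_hull_finite[OF fW] by blast
    then have "y = (\<Sum>a\<in>lift W. u (fst a) *\<^sub>R a)" using x(2) by (simp add: sum_lift)
    also have "\<dots> \<in> span (lift W)" by (intro span_sum span_scale span_base)
    finally show "y \<in> span (lift W)" .
  qed
  moreover have "lift W \<subseteq> pts" using W(1) by (auto simp: pts_iff lift_iff)
  ultimately show ?thesis unfolding basis_def using W(2) independent_lift_iff[OF fW] by simp
qed

lemma affine_basis_exists_vertices:
  obtains W where "W \<subseteq> P \<inter> lattice" "\<not> affine_dependent W" "card W = d + 1"
proof -
  define V where "V = {v. v extreme_point_of P}"
  obtain W where W: "W \<subseteq> V" "\<not> affine_dependent W" "affine hull V = affine hull W"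
    using affine_basis_exists by blast
  have "affine hull P = affine hull V" using P_eq_hull affine_hull_convex_hull unfolding V_def by metis
  then have "int (card W) = aff_dim P + 1" using aff_dim_unique[of W P] W by simp
  then have "card W = d + 1" using aff_dim_P by simp
  then show ?thesis using that[of W] W vertices_lattice unfolding V_def by blast
qed

text \<open>Homogenising adds one dimension; this matches the exponent in
  \<open>delta\<close>.\<close>

lemma dim_pts: "dim pts = d + 1"
proof -
  obtain W where W: "W \<subseteq> P \<inter> lattice" "\<not> affine_dependent W" "card W = d + 1"
    by (rule affine_basis_exists_vertices)
  have "card (lift W) = card W" unfolding lift_def by (rule card_image) (auto simp: inj_on_def)
  then show ?thesis using basis_card[OF basis_lift[OF W]] W(3) by simp
qed

lemma empty_simplexD:
  assumes "empty_simplex P d W"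
  shows "basis (lift W)" "pts \<inter> pos_span (lift W) = lift W"
proof -
  have W: "finite W" "\<not> affine_dependent W" "card W = d + 1" "convex hull W \<subseteq> P" "convex hull W \<inter> lattice = W"
    using assms by (auto simp: empty_simplex_def)
  show "basis (lift W)" by (rule basis_lift) (use W in auto)
  have "(x, t) \<in> pts \<inter> pos_span (lift W) \<longleftrightarrow> (x, t) \<in> lift W" for x t
    using W(4,5) pos_span_lift_degree_1[OF W(1), of x] by (auto simp: pts_iff lift_iff)
  then show "pts \<inter> pos_span (lift W) = lift W" by (metis subrelI subset_antisym)
qed

lemma empty_simplexI:
  assumes B: "basis B" "pts \<inter> pos_span B = B"
  obtains W where "empty_simplex P d W" "B = lift W"
proof -
  define W where "W = fst ` B"
  have BA: "B \<subseteq> lift (P \<inter> lattice)" using B(1) by (simp add: basis_def pts_eq[symmetric])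
  then have BW: "B = lift W" unfolding W_def lift_def by force
  have WP: "W \<subseteq> P \<inter> lattice" using BA unfolding W_def lift_def by auto
  have fW: "finite W" unfolding W_def using basis_finite[OF B(1)] by simp
  have "card W = card B" unfolding BW lift_def by (rule card_image[symmetric]) (auto simp: inj_on_def)
  then have "card W = d + 1" using basis_card[OF B(1)] dim_pts by simp
  moreover have "\<not> affine_dependent W" using independent_lift_iff[OF fW] B(1) BW by (simp add: basis_def)
  moreover have hW: "convex hull W \<subseteq> P"
    using WP polytope_imp_convex[OF polytope_P] by (simp add: hull_minimal)
  moreover have "convex hull W \<inter> lattice = W"
  proof
    show "convex hull W \<inter> lattice \<subseteq> W"
    proof
      fix x assume x: "x \<in> convex hull W \<inter> lattice"
      then have "(x, 1) \<in> pts \<inter> pos_span B"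
        using hW pos_span_lift_degree_1[OF fW, of x] BW by (auto simp: pts_iff)
      then show "x \<in> W" using B(2) W_def by force
    qed
    show "W \<subseteq> convex hull W \<inter> lattice" using WP hull_subset[of W convex] by auto
  qed
  ultimately have "empty_simplex P d W" unfolding empty_simplex_def using fW by blast
  then show ?thesis using that BW by blast
qed

lemma box_simplex_eq:
  assumes B: "basis (lift W)"
  shows "box_simplex W = pbox (lift W)"
proof
  show "box_simplex W \<subseteq> pbox (lift W)"
  proof
    fix y assume "y \<in> box_simplex W"
    then obtain r where r: "y \<in> lattice1" "\<forall>w\<in>W. 0 \<le> r w \<and> r w < 1" "y = (\<Sum>w\<in>W. r w *\<^sub>R (w, 1))"
      unfolding box_simplex_def by blast
    have y: "y = (\<Sum>a\<in>lift W. r (fst a) *\<^sub>R a)" unfolding r(3) sum_lift sum_scaleR_pair by simp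
    have "y \<in> span (lift W)" unfolding y by (intro span_sum span_scale span_base)
    moreover have "coord (lift W) y a = r (fst a)" if "a \<in> lift W" for a
      using coord_unique[OF B y that] .
    ultimately show "y \<in> pbox (lift W)"
      using r(1,2) basis_span[OF B] by (auto simp: pbox_def lift_iff)
  qed
  show "pbox (lift W) \<subseteq> box_simplex W"
  proof
    fix y assume y: "y \<in> pbox (lift W)"
    then have "y = (\<Sum>a\<in>lift W. coord (lift W) y a *\<^sub>R a)" using coord_sum[OF B] by (simp add: pbox_def)
    then have "y = (\<Sum>w\<in>W. coord (lift W) y (w, 1) *\<^sub>R (w, 1))" unfolding sum_lift sum_scaleR_pair .
    then show "y \<in> box_simplex W"
      unfolding box_simplex_def using y
      by (intro CollectI conjI exI[of _ "\<lambda>w. coord (lift W) y (w, 1)"]) (auto simp: pbox_def lift_iff)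
  qed
qed

section \<open>Box elements and the bound on \<open>mu_hole\<close>\<close>

lemma box_poly_iff:
  "y \<in> box_poly P \<longleftrightarrow> (\<exists>B. basis B \<and> pts \<inter> pos_span B = B \<and> y \<in> pbox B) \<and> (\<nexists>xs. set xs \<subseteq> pts \<and> y = sum_list xs)"
proof -
  have "(\<exists>W. empty_simplex P d W \<and> y \<in> box_simplex W) \<longleftrightarrow>
      (\<exists>B. basis B \<and> pts \<inter> pos_span B = B \<and> y \<in> pbox B)"
    using empty_simplexD empty_simplexI box_simplex_eq by metis
  then show ?thesis unfolding box_poly_def nonneg_int_comb_eq aff_dim_P nat_int pts_def[symmetric] by blast
qed

lemma box_poly_M: "box_poly P \<subseteq> M"
  using box_poly_iff box_M by blast

lemma finite_box_poly: "finite (box_poly P)"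
proof -
  have "box_poly P \<subseteq> {y \<in> M. snd y \<le> real (d + 1)}"
  proof
    fix y assume y: "y \<in> box_poly P"
    then obtain B where B: "basis B" "y \<in> pbox B" using box_poly_iff by blast
    show "y \<in> {y \<in> M. snd y \<le> real (d + 1)}"
      using box_degree_less[OF B] y box_poly_M dim_pts by auto
  qed
  then show ?thesis using finite_degree_le finite_subset by blast
qed

lemma box_poly_deg_pos: assumes "y \<in> box_poly P" shows "1 \<le> deg y"
proof -
  have "\<nexists>xs. set xs \<subseteq> pts \<and> y = sum_list xs" using assms box_poly_iff by blast
  \<comment> \<open>The empty sum is among the excluded combinations, so 0 is never a hole.\<close>
  then have "y \<noteq> sum_list []" by (metis empty_set empty_subsetI)
  then have "1 \<le> snd y" using degree_ge_1[of y] assms box_poly_M by auto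
  then show ?thesis using deg_M box_poly_M assms by (metis of_nat_1 of_nat_le_iff subsetD)
qed

lemma deg_le_mu_hole: assumes "y \<in> box_poly P" shows "deg y \<le> mu_hole P"
  using assms finite_box_poly by (auto simp: mu_hole_def)

lemma mu_hole_cases:
  obtains "box_poly P = {}" "mu_hole P = 1" | y where "y \<in> box_poly P" "mu_hole P = deg y"
proof (cases "box_poly P = {}")
  case False
  then have "Max (deg ` box_poly P) \<in> deg ` box_poly P" using finite_box_poly by (intro Max_in) auto
  then show ?thesis using that False by (auto simp: mu_hole_def)
qed (use that in \<open>auto simp: mu_hole_def\<close>)

lemma mu_hole_pos: "1 \<le> mu_hole P"
  by (rule mu_hole_cases) (use box_poly_deg_pos in auto)

lemma hole_bound:
  assumes "basis B" "pts \<inter> pos_span B = B" "y \<in> pbox B" "\<nexists>xs. set xs \<subseteq> pts \<and> y = sum_list xs"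
  shows "snd y \<le> real (mu_hole P)"
proof -
  have "y \<in> box_poly P" using assms box_poly_iff by blast
  then show ?thesis using deg_le_mu_hole deg_M box_poly_M by (metis of_nat_le_iff subsetD)
qed

lemma mu_hole_le: assumes "2 \<le> d" shows "mu_hole P \<le> d - 1"
proof (rule mu_hole_cases)
  fix y assume y: "y \<in> box_poly P" "mu_hole P = deg y"
  then obtain B where B: "basis B" "pts \<inter> pos_span B = B" "y \<in> pbox B" using box_poly_iff by blast
  have "snd y \<le> real (d + 1) - 2" using empty_box_degree[OF B] assms dim_pts by simp
  then have "real (deg y) \<le> real (d + 1) - 2" using deg_M box_poly_M y(1) by (metis subsetD)
  then show ?thesis using y(2) assms by simp
qed (use assms in auto)

section \<open>The delta-vector and \<open>mu_Ehr\<close>\<close>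

lemma ehrhart_lattice_count: "ehrhart = (\<lambda>n. int (lattice_count P n))"
proof
  fix n
  have "card ((\<lambda>x. (x, real n)) ` (dilate (real n) P \<inter> lattice)) = card (dilate (real n) P \<inter> lattice)"
    by (rule card_image) (auto simp: inj_on_def)
  then show "ehrhart n = int (lattice_count P n)"
    unfolding ehrhart_def lattice_count_def by (subst degree_slice) auto
qed

lemma delta_eq: "delta P j = fps_nth ((1 - fps_X) ^ dim pts * Abs_fps ehrhart) j"
  unfolding delta_def ehrhart_lattice_count dim_pts aff_dim_P nat_int ..

lemma delta_eq_0: assumes "d < j" shows "delta P j = 0"
proof -
  obtain W where W: "W \<subseteq> P \<inter> lattice" "\<not> affine_dependent W" "card W = d + 1"
    by (rule affine_basis_exists_vertices)
  show ?thesis unfolding delta_eq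
    by (rule ehrhart_numerator_eq_0[OF basis_lift[OF W]]) (use assms dim_pts in simp)
qed

lemma delta_hole_pos: assumes y: "y \<in> box_poly P" shows "0 < delta P (deg y)"
proof -
  obtain B where B: "basis B" "y \<in> pbox B" using y box_poly_iff by blast
  show ?thesis unfolding delta_eq
    by (rule ehrhart_numerator_pos[OF B(1), of y]) (use B(2) deg_M[of y] box_poly_M y in \<open>auto simp: pbox_def\<close>)
qed

lemma mu_Ehr_ge: assumes "0 < j" "delta P j \<noteq> 0" shows "j \<le> mu_Ehr P"
proof -
  have "j \<le> (GREATEST i. 0 < i \<and> delta P i \<noteq> 0)"
    \<comment> \<open>\<open>GREATEST\<close> needs an upper bound on the indices; vanishing beyond
      \<open>d\<close> provides it.\<close>
    by (rule Greatest_le_nat[of _ _ d]) (use assms delta_eq_0 in \<open>auto simp: not_less[symmetric]\<close>)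
  moreover have "\<exists>i>0. delta P i \<noteq> 0" using assms by blast
  ultimately show ?thesis by (simp add: mu_Ehr_def)
qed

text \<open>The first case covers the default value, taken when only the constant coefficient can be
  nonzero, as for a unimodular simplex.\<close>

lemma mu_Ehr_cases:
  obtains "mu_Ehr P = 1" | "0 < mu_Ehr P" "delta P (mu_Ehr P) \<noteq> 0"
proof (cases "\<exists>i>0. delta P i \<noteq> 0")
  case False
  then have "mu_Ehr P = 1" unfolding mu_Ehr_def by (rule if_not_P)
  then show ?thesis by (rule that)
next
  case True
  then obtain i where "0 < i \<and> delta P i \<noteq> 0" by blast
  then have "0 < (GREATEST i. 0 < i \<and> delta P i \<noteq> 0) \<and> delta P (GREATEST i. 0 < i \<and> delta P i \<noteq> 0) \<noteq> 0"
    by (rule GreatestI_nat[of _ _ d]) (use delta_eq_0 in \<open>auto simp: not_less[symmetric]\<close>)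
  then show ?thesis using that True by (simp add: mu_Ehr_def)
qed

lemma mu_Ehr_le: assumes "1 \<le> d" shows "mu_Ehr P \<le> d"
  by (rule mu_Ehr_cases) (use assms delta_eq_0 in \<open>auto simp: not_less[symmetric]\<close>)

lemma mu_hole_le_mu_Ehr: "mu_hole P \<le> mu_Ehr P"
proof (rule mu_hole_cases)
  \<comment> \<open>Without holes only positivity of \<open>mu_Ehr\<close> is required, and both of
    its cases give it.\<close>
  assume "mu_hole P = 1"
  then show ?thesis by (metis One_nat_def Suc_leI mu_Ehr_cases order_refl)
next
  fix y assume y: "y \<in> box_poly P" "mu_hole P = deg y"
  then show ?thesis using mu_Ehr_ge[of "deg y"] delta_hole_pos[OF y(1)] box_poly_deg_pos[OF y(1)] by simp
qed

section \<open>Decomposition invariants and the Hilbert basis\<close>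

lemma decomp_at_dilateI:
  assumes "\<And>z. z \<in> M \<Longrightarrow> snd z = real (k * n) \<Longrightarrow>
    \<exists>f. (\<forall>i<k. f i \<in> M \<and> snd (f i) = real n) \<and> z = (\<Sum>i<k. f i)"
  shows "decomp_at (dilate (real n) P) k"
  unfolding decomp_at_def
proof
  fix x assume x: "x \<in> dilate (real k) (dilate (real n) P) \<inter> lattice"
  then have "(x, real (k * n)) \<in> M"
    unfolding M_def using mem_pos_span_pts by (auto simp: dilate_dilate lattice1_iff)
  then obtain f where f: "\<forall>i<k. f i \<in> M \<and> snd (f i) = real n" "(x, real (k * n)) = (\<Sum>i<k. f i)"
    using assms by fastforce
  have "fst (f i) \<in> dilate (real n) P \<inter> lattice" if "i < k" for i
    using f(1) that mem_pos_span_pts by (cases "f i") (auto simp: M_def lattice1_iff)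
  moreover have "x = (\<Sum>i<k. fst (f i))" using f(2) by (metis fst_conv fst_sum)
  ultimately show "\<exists>f. (\<forall>i<k. f i \<in> dilate (real n) P \<inter> lattice) \<and> x = (\<Sum>i<k. f i)"
    by (intro exI[of _ "\<lambda>i. fst (f i)"]) auto
qed

lemma IDP_dilate: assumes "mu_hole P \<le> n" shows "IDP (dilate (real n) P)"
  unfolding IDP_def
proof (intro allI impI)
  fix k :: nat assume k: "1 \<le> k"
  show "decomp_at (dilate (real n) P) k"
    by (rule decomp_at_dilateI, rule decomposition_hole_bound[OF mu_hole_pos hole_bound assms k])
qed

text \<open>A \<open>LEAST\<close> needs a witness. \<open>mu_hole\<close> is the one for
  \<open>mu_idp\<close>, which then serves \<open>mu_midp\<close>, which serves
  \<open>mu_va\<close>; minimality turns each witness into an inequality.\<close>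

lemma mu_idp_props: "0 < mu_idp P" "IDP (dilate (real (mu_idp P)) P)" "mu_idp P \<le> mu_hole P"
proof -
  let ?Q = "\<lambda>k. 0 < k \<and> (\<forall>n\<ge>k. IDP (dilate (real n) P))"
  have Q: "?Q (mu_hole P)" using IDP_dilate mu_hole_pos by auto
  have "?Q (mu_idp P)" unfolding mu_idp_def by (rule LeastI[of ?Q, OF Q])
  then show "0 < mu_idp P" "IDP (dilate (real (mu_idp P)) P)" by auto
  show "mu_idp P \<le> mu_hole P" unfolding mu_idp_def by (rule Least_le[of ?Q, OF Q])
qed

lemma mu_midp_props: "0 < mu_midp P" "IDP (dilate (real (mu_midp P)) P)" "mu_midp P \<le> mu_idp P"
proof -
  let ?Q = "\<lambda>k. 0 < k \<and> IDP (dilate (real k) P)"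
  have Q: "?Q (mu_idp P)" using mu_idp_props by auto
  have "?Q (mu_midp P)" unfolding mu_midp_def by (rule LeastI[of ?Q, OF Q])
  then show "0 < mu_midp P" "IDP (dilate (real (mu_midp P)) P)" by auto
  show "mu_midp P \<le> mu_idp P" unfolding mu_midp_def by (rule Least_le[of ?Q, OF Q])
qed

lemma mu_va_le: assumes "0 < k" "very_ample (dilate (real k) P)" shows "mu_va P \<le> k"
  unfolding mu_va_def by (rule Least_le) (use assms in simp)

lemma mu_va_pos: "1 \<le> mu_va P" and mu_va_le_mu_midp: "mu_va P \<le> mu_midp P"
proof -
  let ?Q = "\<lambda>k. 0 < k \<and> very_ample (dilate (real k) P)"
  have Q: "?Q (mu_midp P)" using mu_midp_props by (auto simp: IDP_def very_ample_def)
  have "?Q (mu_va P)" unfolding mu_va_def by (rule LeastI[of ?Q, OF Q])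
  then show "1 \<le> mu_va P" by simp
  show "mu_va P \<le> mu_midp P" using mu_va_le Q by blast
qed

text \<open>An atom can be generated only by being a generator itself, and the atoms generate
  everything by induction on the degree.\<close>

lemma generating_iff:
  assumes "H \<subseteq> M"
  shows "nonneg_int_comb H = M \<longleftrightarrow> irreducibles \<subseteq> H"
proof
  assume eq: "nonneg_int_comb H = M"
  show "irreducibles \<subseteq> H"
  proof
    fix y assume y: "y \<in> irreducibles"
    then have "y \<in> nonneg_int_comb H" using eq by (simp add: irreducibles_def)
    then obtain xs where "set xs \<subseteq> H" "y = sum_list xs" unfolding nonneg_int_comb_eq by blast
    then show "y \<in> H" using irreducible_in_list[of xs] assms y by blast
  qed
next
  assume "irreducibles \<subseteq> H"
  have "M \<subseteq> nonneg_int_comb H"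
  proof
    fix y assume "y \<in> M"
    then obtain ys where "set ys \<subseteq> irreducibles" "y = sum_list ys"
      by (rule irreducible_decomposition)
    then show "y \<in> nonneg_int_comb H"
      unfolding nonneg_int_comb_eq using \<open>irreducibles \<subseteq> H\<close> by blast
  qed
  moreover have "nonneg_int_comb H \<subseteq> M"
    unfolding nonneg_int_comb_eq using assms M_sum_list by blast
  ultimately show "nonneg_int_comb H = M" by blast
qed

lemma irreducibles_finite: "finite irreducibles"
  by (rule finite_irreducibles[OF mu_hole_pos hole_bound])

text \<open>The generating sets are exactly the subsets of \<open>M\<close> containing the atoms, so
  the atoms are the only minimal one; this discharges the \<open>THE\<close>.\<close>

lemma hilbert_basis_eq: "hilbert_basis P = irreducibles"
  unfolding hilbert_basis_def M_eq[symmetric]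
proof (rule the_equality)
  have iM: "irreducibles \<subseteq> M" by (auto simp: irreducibles_def)
  show "finite irreducibles \<and> irreducibles \<subseteq> M \<and> nonneg_int_comb irreducibles = M \<and>
      (\<forall>H'. H' \<subset> irreducibles \<longrightarrow> nonneg_int_comb H' \<noteq> M)"
    using generating_iff iM irreducibles_finite by blast
  fix H assume "finite H \<and> H \<subseteq> M \<and> nonneg_int_comb H = M \<and> (\<forall>H'. H' \<subset> H \<longrightarrow> nonneg_int_comb H' \<noteq> M)"
  then show "H = irreducibles" using generating_iff iM by blast
qed

lemma mu_Hilb_props:
  shows mu_Hilb_le_mu_hole: "mu_Hilb P \<le> mu_hole P" and mu_Hilb_pos: "0 < mu_Hilb P"
    and irreducible_le_mu_Hilb: "y \<in> irreducibles \<Longrightarrow> snd y \<le> real (mu_Hilb P)"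
proof -
  have fin: "finite (deg ` irreducibles)" using irreducibles_finite by blast
  have iM: "irreducibles \<subseteq> M - {0}" by (auto simp: irreducibles_def)
  have "mu_Hilb P \<in> deg ` irreducibles"
    unfolding mu_Hilb_def hilbert_basis_eq using fin irreducibles_nonempty by (intro Max_in) auto
  then obtain z where z: "z \<in> irreducibles" "mu_Hilb P = deg z" by blast
  have dz: "real (deg z) = snd z" using deg_M z(1) iM by blast
  show "mu_Hilb P \<le> mu_hole P"
  proof -
    have "snd z \<le> real (mu_hole P)"
      by (rule irreducible_degree_le[OF mu_hole_pos hole_bound z(1)])
    then show ?thesis using z(2) dz by linarith
  qed
  show "0 < mu_Hilb P" using degree_ge_1[of z] z iM dz by (metis DiffD1 DiffD2 gr0I insertCI not_one_le_zero of_nat_0 subsetD)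
  show "snd y \<le> real (mu_Hilb P)" if y: "y \<in> irreducibles"
  proof -
    have "deg y \<le> mu_Hilb P" unfolding mu_Hilb_def hilbert_basis_eq using fin y by (intro Max_ge) auto
    moreover have "real (deg y) = snd y" using deg_M y iM by blast
    ultimately show ?thesis by linarith
  qed
qed

lemma mu_va_le_mu_Hilb: "mu_va P \<le> mu_Hilb P"
proof (rule mu_va_le[OF mu_Hilb_pos])
  \<comment> \<open>The threshold \<open>d + 1\<close> is \<open>dim pts\<close>, which bounds the
    number of atoms in a box element.\<close>
  have "decomp_at (dilate (real (mu_Hilb P)) P) k" if "d + 1 \<le> k" for k
    by (rule decomp_at_dilateI, rule decomposition_irreducible_bound[OF irreducible_le_mu_Hilb])
       (use that dim_pts in auto)
  then show "very_ample (dilate (real (mu_Hilb P)) P)" unfolding very_ample_def by blast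
qed

end

theorem theorem1p1:
  fixes P :: "(real^'n) set" and d :: nat
  assumes "integral_polytope P" and "aff_dim P = int d" and "1 \<le> d"
  shows "1 \<le> mu_va P \<and> mu_va P \<le> mu_midp P \<and> mu_midp P \<le> mu_idp P \<and>
         mu_idp P \<le> mu_hole P \<and> mu_hole P \<le> mu_Ehr P \<and> mu_Ehr P \<le> d \<and>
         1 \<le> mu_va P \<and> mu_va P \<le> mu_Hilb P \<and> mu_Hilb P \<le> mu_hole P \<and>
         (2 \<le> d \<longrightarrow> mu_hole P \<le> d - 1)"
proof -
  interpret int_polytope P d by unfold_locales (use assms in auto)
  show ?thesis
    using mu_va_pos mu_va_le_mu_midp mu_midp_props(3) mu_idp_props(3) mu_hole_le_mu_Ehr mu_Ehr_le[OF assms(3)]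
      mu_va_le_mu_Hilb mu_Hilb_le_mu_hole mu_hole_le by blast
qed

end
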